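(* Let $\mathcal{T}_{\mathsf{ML}}$ be a dependent type theory with identity types, the $\mathrm{J}$ rule, and its definitional computation rule. Given a (closed) type $A$ in $\mathcal{T}_{\mathsf{ML}}$, the globular set $A^{\mathsf G}$ has a structure of (syntactic) weak $\infty$-groupoid.
   Context: Globular sets. A globular set is a sequence of sets $(A_n)_{n\in\mathbb N}$ with maps $s_n,t_n:A_{n+1}\to A_n$ such that $s_n s_{n+1}=s_n t_{n+1}$ and $t_n s_{n+1}=t_n t_{n+1}$. $\mathrm{Ob}(A):=A_0$; for $x,y\in A_0$, $\mathrm{Hom}_A(x,y)$ is the globular set of higher cells with iterated $0$-source $x$ and $0$-target $y$, $(\mathrm{Hom}_A(x,y))_n=\{\sigma\in A_{n+1}: s_0\cdots s_n(\sigma)=x,\ t_0\cdots t_n(\sigma)=y\}$. $\mathrm{Glob}$ is the (large) set of globular sets. For a closed type $A$ of $\mathcal T_{\mathsf{ML}}$, $A^{\mathsf G}$ is defined by $\mathrm{Ob}(A^{\mathsf G}):=\{t\mid\ \vdash t:A\}$ and $\mathrm{Hom}_{A^{\mathsf G}}(t,u):=(\mathrm{Id}_A(t,u))^{\mathsf G}$. The type theory $\mathcal T_\infty$. Syntax: contexts $\Gamma::=\varnothing\mid(\Gamma,x:T)$; context morphisms $\gamma::=()\mid(\gamma,u)$; types $T::=\star\mid u\simeq_Tv$; terms $u::=x\mid\mathsf{coh}_{\Delta.T}(\delta)$. Here $\mathsf{coh}_{\Delta.T}$ is an atomic symbol, variables in its subscript are not free, and substitution $X[\gamma/\Gamma]$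 (replacing the variables of $\Gamma$ by the terms of $\gamma$) acts only in the argument $\delta$. Typing rules: - Contexts: $\varnothing$ is a context; if $\Gamma\vdash T$ type and $x\notin\Gamma$ then $(\Gamma,x:T)$ is a context. - Context morphisms: $\Gamma\vdash():\varnothing$; if $\Gamma'\vdash T$ type, $\Gamma\vdash\gamma:\Gamma'$ and $\Gamma\vdash u:T[\gamma/\Gamma']$, with $x\notin\Gamma'$, then $\Gamma\vdash(\gamma,u):(\Gamma',x:T)$. - Types: $\Gamma\vdash\star$ type; if $\Gamma\vdash u:T$ and $\Gamma\vdash v:T$ then $\Gamma\vdash u\simeq_Tv$ type. - Terms: $\Gamma\vdash x:T$ if $(x:T)\in\Gamma$; if $\Delta$ is contractible, $\Delta\vdash T$ type and $\Gamma\vdash\delta:\Delta$, then $\Gamma\vdash\mathsf{coh}_{\Delta.T}(\delta):T[\delta/\Delta]$. - Contractible contexts: $(x:\star)$ is contractible; if $\Delta$ is contractible and $\Delta\vdash u:T$ then $(\Delta,y:T,z:u\simeq_Ty)$ is contractible ($y,z\notin\Delta$). Depth: $\mathrm{depth}(\mathsf{coh}_{\Delta.T}(\delta))=\max(\mathrm{depth}(\delta),\mathrm{depth}(T)+1,\mathrm{depth}(\Delta)+1)$; $\mathrm{depth}(u\simeq_Tv)=\max(\mathrm{depth}(u),\mathrm{depth}(v),\mathrm{depth}(T))$; $\mathrm{depth}((\gamma,u))=\max(\mathrm{depth}(\gamma),\mathrm{depth}(u))$; $\star$, variables and $()$ have depth $0$; the depth of a context is the maximum of the depths of its types ($0$ if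 empty). Partial weak $\infty$-groupoids. A $0$-partial weak $\infty$-groupoid is a globular set $G$. An $(n+1)$-partial weak $\infty$-groupoid is an $n$-partial one $G$ together with, for every contractible context $\Delta$ and every type $T$ in context $\Delta$ with $\max(\mathrm{depth}(\Delta),\mathrm{depth}(T))=n$, a function $\mathbf{coh}^G_{\Delta.T}:(\eta:\llbracket\Delta\rrbracket^G)\to\mathrm{Ob}(\llbracket T\rrbracket^G_\Delta(\eta))$. The interpretation, for an $n$-partial $G$, of well-typed expressions of depth at most $n$ is: - $\llbracket\varnothing\rrbracket^G=\{()\}$, $\llbracket(\Gamma,x:T)\rrbracket^G=\{(\gamma,a)\mid\gamma\in\llbracket\Gamma\rrbracket^G,\ a\in\mathrm{Ob}(\llbracket T\rrbracket^G_\Gamma(\gamma))\}$; - $\llbracket()\rrbracket^G_{\Gamma,\varnothing}(\gamma)=()$, $\llbracket(\theta,u)\rrbracket^G_{\Gamma,(\Theta,x:T)}(\gamma)=(\llbracket\theta\rrbracket^G_{\Gamma,\Theta}(\gamma),\llbracket u\rrbracket^G_{\Gamma,T[\theta/\Theta]}(\gamma))$; - $\llbracket\star\rrbracket^G_\Gamma(\gamma)=G$, $\llbracket u\simeq_Tv\rrbracket^G_\Gamma(\gamma)=\mathrm{Hom}_{\llbracket T\rrbracket^G_\Gamma(\gamma)}(\llbracket u\rrbracket^G_{\Gamma,T}(\gamma),\llbracket v\rrbracket^G_{\Gamma,T}(\gamma))$; - $\llbracket x\rrbracket^G_{\Gamma,T}(\gamma)=$ the component of $\gamma$ corresponding to $x$,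 $\llbracket\mathsf{coh}_{\Delta.T}(\delta)\rrbracket^G_{\Gamma,T[\delta/\Delta]}(\gamma)=\mathbf{coh}^G_{\Delta.T}(\llbracket\delta\rrbracket^G_{\Gamma,\Delta}(\gamma))$. A (syntactic) weak $\infty$-groupoid is a globular set $G$ together with, for every $n\in\mathbb N$, a structure of $(n+1)$-partial weak $\infty$-groupoid over the previous structure of $n$-partial weak $\infty$-groupoid; in particular, a function $\mathbf{coh}^G_{\Delta.T}$ for every contractible $\Delta$ and every type $T$ in $\Delta$. *)

theory Defs
  imports Main
begin

section \<open>Globular sets\<close>

record 'c globular =
  cells :: "nat \<Rightarrow> 'c set"
  src :: "nat \<Rightarrow> 'c \<Rightarrow> 'c"
  tgt :: "nat \<Rightarrow> 'c \<Rightarrow> 'c"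

definition globular_set :: "'c globular \<Rightarrow> bool" where
  "globular_set G \<longleftrightarrow>
    (\<forall>n. \<forall>x \<in> cells G (Suc n). src G n x \<in> cells G n \<and> tgt G n x \<in> cells G n) \<and>
    (\<forall>n. \<forall>x \<in> cells G (Suc (Suc n)).
       src G n (src G (Suc n) x) = src G n (tgt G (Suc n) x) \<and>
       tgt G n (src G (Suc n) x) = tgt G n (tgt G (Suc n) x))"

definition Ob :: "'c globular \<Rightarrow> 'c set" where
  "Ob G = cells G 0"

text \<open>\<open>src0 G n = s\<^sub>0 \<circ> \<dots> \<circ> s\<^bsub>n-1\<^esub>\<close> maps \<open>n\<close>-cells to \<open>0\<close>-cells; likewise \<open>tgt0\<close>.\<close>

primrec src0 :: "'c globular \<Rightarrow> nat \<Rightarrow> 'c \<Rightarrow> 'c" where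
  "src0 G 0 x = x"
| "src0 G (Suc n) x = src0 G n (src G n x)"

primrec tgt0 :: "'c globular \<Rightarrow> nat \<Rightarrow> 'c \<Rightarrow> 'c" where
  "tgt0 G 0 x = x"
| "tgt0 G (Suc n) x = tgt0 G n (tgt G n x)"

definition Hom :: "'c globular \<Rightarrow> 'c \<Rightarrow> 'c \<Rightarrow> 'c globular" where
  "Hom G x y =
    \<lparr> cells = (\<lambda>n. {z \<in> cells G (Suc n). src0 G (Suc n) z = x \<and> tgt0 G (Suc n) z = y}),
      src = (\<lambda>n. src G (Suc n)),
      tgt = (\<lambda>n. tgt G (Suc n)) \<rparr>"


section \<open>Dependent type theories with identity types\<close>

text \<open>A dependent type theory is given by its raw types and terms (variables being de Bruijn
  indices, with simultaneous substitution) and its four forms of judgement. Only closure under the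
  rules below is required of these, so the theory may have any further type formers, constants and
  rules. A context is a list of types whose head is the type of the variable \<open>0\<close>.

  \<open>J_tm A a P d b q\<close> binds two variables in the motive \<open>P\<close>: \<open>0\<close> is the path, \<open>1\<close> its endpoint.\<close>

record ('T, 't) type_theory =
  tm_var :: "nat \<Rightarrow> 't"
  ty_sub :: "(nat \<Rightarrow> 't) \<Rightarrow> 'T \<Rightarrow> 'T"
  tm_sub :: "(nat \<Rightarrow> 't) \<Rightarrow> 't \<Rightarrow> 't"
  is_type :: "'T list \<Rightarrow> 'T \<Rightarrow> bool"
  has_type :: "'T list \<Rightarrow> 't \<Rightarrow> 'T \<Rightarrow> bool"
  type_eq :: "'T list \<Rightarrow> 'T \<Rightarrow> 'T \<Rightarrow> bool"
  term_eq :: "'T list \<Rightarrow> 't \<Rightarrow> 't \<Rightarrow> 'T \<Rightarrow> bool"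
  Id_ty :: "'T \<Rightarrow> 't \<Rightarrow> 't \<Rightarrow> 'T"
  refl_tm :: "'T \<Rightarrow> 't \<Rightarrow> 't"
  J_tm :: "'T \<Rightarrow> 't \<Rightarrow> 'T \<Rightarrow> 't \<Rightarrow> 't \<Rightarrow> 't \<Rightarrow> 't"

primrec is_ctx :: "('T, 't) type_theory \<Rightarrow> 'T list \<Rightarrow> bool" where
  "is_ctx M [] \<longleftrightarrow> True"
| "is_ctx M (A # \<Gamma>) \<longleftrightarrow> is_ctx M \<Gamma> \<and> is_type M \<Gamma> A"

definition shift :: "('T, 't) type_theory \<Rightarrow> nat \<Rightarrow> nat \<Rightarrow> 't" where
  "shift M k = (\<lambda>i. tm_var M (i + k))"

definition var_type :: "('T, 't) type_theory \<Rightarrow> 'T list \<Rightarrow> nat \<Rightarrow> 'T" where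
  "var_type M \<Gamma> i = ty_sub M (shift M (Suc i)) (\<Gamma> ! i)"

definition lift_subst :: "('T, 't) type_theory \<Rightarrow> (nat \<Rightarrow> 't) \<Rightarrow> nat \<Rightarrow> 't" where
  "lift_subst M \<sigma> = case_nat (tm_var M 0) (\<lambda>i. tm_sub M (shift M 1) (\<sigma> i))"

text \<open>\<open>inst2 M b q\<close> replaces the variable \<open>0\<close> by \<open>q\<close> and the variable \<open>1\<close> by \<open>b\<close>.\<close>

definition inst2 :: "('T, 't) type_theory \<Rightarrow> 't \<Rightarrow> 't \<Rightarrow> nat \<Rightarrow> 't" where
  "inst2 M b q = case_nat q (case_nat b (tm_var M))"

definition is_subst :: "('T, 't) type_theory \<Rightarrow> 'T list \<Rightarrow> (nat \<Rightarrow> 't) \<Rightarrow> 'T list \<Rightarrow> bool" where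
  "is_subst M \<Delta> \<sigma> \<Gamma> \<longleftrightarrow> is_ctx M \<Delta> \<and> is_ctx M \<Gamma> \<and>
    (\<forall>i < length \<Gamma>. has_type M \<Delta> (\<sigma> i) (ty_sub M \<sigma> (var_type M \<Gamma> i)))"

definition subst_eq ::
  "('T, 't) type_theory \<Rightarrow> 'T list \<Rightarrow> (nat \<Rightarrow> 't) \<Rightarrow> (nat \<Rightarrow> 't) \<Rightarrow> 'T list \<Rightarrow> bool" where
  "subst_eq M \<Delta> \<sigma> \<tau> \<Gamma> \<longleftrightarrow> is_subst M \<Delta> \<sigma> \<Gamma> \<and> is_subst M \<Delta> \<tau> \<Gamma> \<and>
    (\<forall>i < length \<Gamma>. term_eq M \<Delta> (\<sigma> i) (\<tau> i) (ty_sub M \<sigma> (var_type M \<Gamma> i)))"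

locale dependent_type_theory =
  fixes M :: "('T, 't) type_theory"
  assumes tm_sub_var: "tm_sub M \<sigma> (tm_var M i) = \<sigma> i"
    and tm_sub_id: "tm_sub M (tm_var M) t = t"
    and ty_sub_id: "ty_sub M (tm_var M) A = A"
    and tm_sub_comp: "tm_sub M \<tau> (tm_sub M \<sigma> t) = tm_sub M (\<lambda>i. tm_sub M \<tau> (\<sigma> i)) t"
    and ty_sub_comp: "ty_sub M \<tau> (ty_sub M \<sigma> A) = ty_sub M (\<lambda>i. tm_sub M \<tau> (\<sigma> i)) A"
  \<comment> \<open>the free variables of an expression in context \<open>\<Gamma>\<close> are among those of \<open>\<Gamma>\<close>\<close>
    and ty_scope: "is_type M \<Gamma> A \<Longrightarrow> (\<And>i. i < length \<Gamma> \<Longrightarrow> \<sigma> i = \<tau> i) \<Longrightarrow> ty_sub M \<sigma> A = ty_sub M \<tau> A"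
    and tm_scope: "has_type M \<Gamma> t A \<Longrightarrow> (\<And>i. i < length \<Gamma> \<Longrightarrow> \<sigma> i = \<tau> i) \<Longrightarrow> tm_sub M \<sigma> t = tm_sub M \<tau> t"
    and is_type_ctx: "is_type M \<Gamma> A \<Longrightarrow> is_ctx M \<Gamma>"
    and has_type_type: "has_type M \<Gamma> t A \<Longrightarrow> is_type M \<Gamma> A"
    and type_eq_types: "type_eq M \<Gamma> A B \<Longrightarrow> is_type M \<Gamma> A \<and> is_type M \<Gamma> B"
    and term_eq_terms: "term_eq M \<Gamma> t u A \<Longrightarrow> has_type M \<Gamma> t A \<and> has_type M \<Gamma> u A"
    and type_eq_refl: "is_type M \<Gamma> A \<Longrightarrow> type_eq M \<Gamma> A A"
    and type_eq_sym: "type_eq M \<Gamma> A B \<Longrightarrow> type_eq M \<Gamma> B A"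
    and type_eq_trans: "type_eq M \<Gamma> A B \<Longrightarrow> type_eq M \<Gamma> B C \<Longrightarrow> type_eq M \<Gamma> A C"
    and term_eq_refl: "has_type M \<Gamma> t A \<Longrightarrow> term_eq M \<Gamma> t t A"
    and term_eq_sym: "term_eq M \<Gamma> t u A \<Longrightarrow> term_eq M \<Gamma> u t A"
    and term_eq_trans: "term_eq M \<Gamma> t u A \<Longrightarrow> term_eq M \<Gamma> u v A \<Longrightarrow> term_eq M \<Gamma> t v A"
    and has_type_conv: "has_type M \<Gamma> t A \<Longrightarrow> type_eq M \<Gamma> A B \<Longrightarrow> has_type M \<Gamma> t B"
    and term_eq_conv: "term_eq M \<Gamma> t u A \<Longrightarrow> type_eq M \<Gamma> A B \<Longrightarrow> term_eq M \<Gamma> t u B"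
  \<comment> \<open>weakening is substitution by the shifted variables\<close>
    and has_type_var: "is_ctx M \<Gamma> \<Longrightarrow> i < length \<Gamma> \<Longrightarrow> has_type M \<Gamma> (tm_var M i) (var_type M \<Gamma> i)"
    and is_type_sub: "is_subst M \<Delta> \<sigma> \<Gamma> \<Longrightarrow> is_type M \<Gamma> A \<Longrightarrow> is_type M \<Delta> (ty_sub M \<sigma> A)"
    and has_type_sub: "is_subst M \<Delta> \<sigma> \<Gamma> \<Longrightarrow> has_type M \<Gamma> t A \<Longrightarrow>
          has_type M \<Delta> (tm_sub M \<sigma> t) (ty_sub M \<sigma> A)"
    and type_eq_sub: "subst_eq M \<Delta> \<sigma> \<tau> \<Gamma> \<Longrightarrow> type_eq M \<Gamma> A B \<Longrightarrow>
          type_eq M \<Delta> (ty_sub M \<sigma> A) (ty_sub M \<tau> B)"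
    and term_eq_sub: "subst_eq M \<Delta> \<sigma> \<tau> \<Gamma> \<Longrightarrow> term_eq M \<Gamma> t u A \<Longrightarrow>
          term_eq M \<Delta> (tm_sub M \<sigma> t) (tm_sub M \<tau> u) (ty_sub M \<sigma> A)"

text \<open>The J rule is the one with a fixed left endpoint \<open>a\<close>: the motive is a type
  \<open>\<Gamma>, y : A, p : Id\<^sub>A(a, y) \<turnstile> P\<close>.\<close>

definition J_ctx :: "('T, 't) type_theory \<Rightarrow> 'T list \<Rightarrow> 'T \<Rightarrow> 't \<Rightarrow> 'T list" where
  "J_ctx M \<Gamma> A a =
    Id_ty M (ty_sub M (shift M 1) A) (tm_sub M (shift M 1) a) (tm_var M 0) # A # \<Gamma>"

locale type_theory_with_identity_types = dependent_type_theory M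
  for M :: "('T, 't) type_theory" +
  assumes Id_sub: "ty_sub M \<sigma> (Id_ty M A a b) = Id_ty M (ty_sub M \<sigma> A) (tm_sub M \<sigma> a) (tm_sub M \<sigma> b)"
    and refl_sub: "tm_sub M \<sigma> (refl_tm M A a) = refl_tm M (ty_sub M \<sigma> A) (tm_sub M \<sigma> a)"
    and J_sub: "tm_sub M \<sigma> (J_tm M A a P d b q) =
          J_tm M (ty_sub M \<sigma> A) (tm_sub M \<sigma> a) (ty_sub M (lift_subst M (lift_subst M \<sigma>)) P)
            (tm_sub M \<sigma> d) (tm_sub M \<sigma> b) (tm_sub M \<sigma> q)"
    and Id_form: "has_type M \<Gamma> a A \<Longrightarrow> has_type M \<Gamma> b A \<Longrightarrow> is_type M \<Gamma> (Id_ty M A a b)"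
    and refl_intro: "has_type M \<Gamma> a A \<Longrightarrow> has_type M \<Gamma> (refl_tm M A a) (Id_ty M A a a)"
    and J_elim: "has_type M \<Gamma> a A \<Longrightarrow> is_type M (J_ctx M \<Gamma> A a) P \<Longrightarrow>
          has_type M \<Gamma> d (ty_sub M (inst2 M a (refl_tm M A a)) P) \<Longrightarrow>
          has_type M \<Gamma> b A \<Longrightarrow> has_type M \<Gamma> q (Id_ty M A a b) \<Longrightarrow>
          has_type M \<Gamma> (J_tm M A a P d b q) (ty_sub M (inst2 M b q) P)"
    and J_comp: "has_type M \<Gamma> a A \<Longrightarrow> is_type M (J_ctx M \<Gamma> A a) P \<Longrightarrow>
          has_type M \<Gamma> d (ty_sub M (inst2 M a (refl_tm M A a)) P) \<Longrightarrow>
          term_eq M \<Gamma> (J_tm M A a P d a (refl_tm M A a)) d (ty_sub M (inst2 M a (refl_tm M A a)) P)"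
    and Id_cong: "type_eq M \<Gamma> A A' \<Longrightarrow> term_eq M \<Gamma> a a' A \<Longrightarrow> term_eq M \<Gamma> b b' A \<Longrightarrow>
          type_eq M \<Gamma> (Id_ty M A a b) (Id_ty M A' a' b')"
    and refl_cong: "type_eq M \<Gamma> A A' \<Longrightarrow> term_eq M \<Gamma> a a' A \<Longrightarrow>
          term_eq M \<Gamma> (refl_tm M A a) (refl_tm M A' a') (Id_ty M A a a)"
    and J_cong: "type_eq M \<Gamma> A A' \<Longrightarrow> term_eq M \<Gamma> a a' A \<Longrightarrow> type_eq M (J_ctx M \<Gamma> A a) P P' \<Longrightarrow>
          term_eq M \<Gamma> d d' (ty_sub M (inst2 M a (refl_tm M A a)) P) \<Longrightarrow>
          term_eq M \<Gamma> b b' A \<Longrightarrow> term_eq M \<Gamma> q q' (Id_ty M A a b) \<Longrightarrow>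
          term_eq M \<Gamma> (J_tm M A a P d b q) (J_tm M A' a' P' d' b' q') (ty_sub M (inst2 M b q) P)"


section \<open>The globular set of a closed type\<close>

text \<open>The equations \<open>Ob(A\<^sup>G) = {t | \<turnstile> t : A}\<close> and \<open>Hom(t, u) = (Id\<^sub>A(t, u))\<^sup>G\<close> determine \<open>A\<^sup>G\<close> only once
  cells record their endpoints, because sources and targets are functions of cells:
  \<open>Arr t u \<sigma>\<close> is the cell \<open>\<sigma>\<close> of \<open>(Id\<^sub>A(t, u))\<^sup>G\<close> seen as a cell of \<open>A\<^sup>G\<close>. The two equations,
  up to the constructors, are the lemmas \<open>Ob_type_globular\<close> and \<open>Hom_type_globular\<close>.\<close>

datatype 't cell = Pt 't | Arr 't 't "'t cell"

primrec type_cells :: "('T, 't) type_theory \<Rightarrow> nat \<Rightarrow> 'T \<Rightarrow> 't cell set" where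
  "type_cells M 0 A = {Pt t | t. has_type M [] t A}"
| "type_cells M (Suc n) A =
    {Arr t u \<sigma> | t u \<sigma>. has_type M [] t A \<and> has_type M [] u A \<and> \<sigma> \<in> type_cells M n (Id_ty M A t u)}"

fun cell_src :: "nat \<Rightarrow> 't cell \<Rightarrow> 't cell" where
  "cell_src 0 (Arr t u \<sigma>) = Pt t"
| "cell_src (Suc n) (Arr t u \<sigma>) = Arr t u (cell_src n \<sigma>)"
| "cell_src n (Pt t) = Pt t"

fun cell_tgt :: "nat \<Rightarrow> 't cell \<Rightarrow> 't cell" where
  "cell_tgt 0 (Arr t u \<sigma>) = Pt u"
| "cell_tgt (Suc n) (Arr t u \<sigma>) = Arr t u (cell_tgt n \<sigma>)"
| "cell_tgt n (Pt t) = Pt t"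

definition type_globular :: "('T, 't) type_theory \<Rightarrow> 'T \<Rightarrow> 't cell globular" where
  "type_globular M A = \<lparr> cells = (\<lambda>n. type_cells M n A), src = cell_src, tgt = cell_tgt \<rparr>"

lemma Ob_type_globular: "Ob (type_globular M A) = Pt ` {t. has_type M [] t A}"
  by (auto simp: Ob_def type_globular_def)

lemma src0_type_globular: "src0 (type_globular M A) (Suc n) (Arr t u \<sigma>) = Pt t"
  by (induction n arbitrary: \<sigma>) (auto simp: type_globular_def)

lemma tgt0_type_globular: "tgt0 (type_globular M A) (Suc n) (Arr t u \<sigma>) = Pt u"
  by (induction n arbitrary: \<sigma>) (auto simp: type_globular_def)

lemma Hom_type_globular:
  assumes "has_type M [] t A" "has_type M [] u A"
  shows "cells (Hom (type_globular M A) (Pt t) (Pt u)) n =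
           Arr t u ` cells (type_globular M (Id_ty M A t u)) n"
    and "src (Hom (type_globular M A) (Pt t) (Pt u)) n (Arr t u \<sigma>) =
           Arr t u (src (type_globular M (Id_ty M A t u)) n \<sigma>)"
    and "tgt (Hom (type_globular M A) (Pt t) (Pt u)) n (Arr t u \<sigma>) =
           Arr t u (tgt (type_globular M (Id_ty M A t u)) n \<sigma>)"
proof -
  have "cells (type_globular M B) k = type_cells M k B" for B k
    by (simp add: type_globular_def)
  then show "cells (Hom (type_globular M A) (Pt t) (Pt u)) n =
           Arr t u ` cells (type_globular M (Id_ty M A t u)) n"
    using assms
    by (auto simp: Hom_def src0_type_globular tgt0_type_globular simp del: src0.simps tgt0.simps)
qed (simp_all add: Hom_def type_globular_def)


section \<open>The type theory \<open>T\<^sub>\<infinity>\<close>\<close>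

type_synonym var = nat

datatype con = CEmp | CExt con var ty
  and ty = Star | Eq tm ty tm
  and tm = Var var | Coh con ty mor
  and mor = MEmp | MExt mor tm

text \<open>\<open>Eq u T v\<close> is \<open>u \<simeq>\<^sub>T v\<close>, and \<open>Coh \<Delta> T \<delta>\<close> is \<open>coh\<^bsub>\<Delta>.T\<^esub>(\<delta>)\<close>.\<close>

primrec con_entries :: "con \<Rightarrow> (var \<times> ty) set" where
  "con_entries CEmp = {}"
| "con_entries (CExt \<Gamma> x T) = insert (x, T) (con_entries \<Gamma>)"

definition con_vars :: "con \<Rightarrow> var set" where
  "con_vars \<Gamma> = fst ` con_entries \<Gamma>"

fun sub_var :: "con \<Rightarrow> mor \<Rightarrow> var \<Rightarrow> tm" where
  "sub_var (CExt \<Gamma> y T) (MExt \<gamma> u) x = (if x = y then u else sub_var \<Gamma> \<gamma> x)"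
| "sub_var _ _ x = Var x"

text \<open>\<open>subst_ty \<Gamma> \<gamma> T\<close> is \<open>T[\<gamma>/\<Gamma>]\<close>.\<close>

primrec subst_ty :: "con \<Rightarrow> mor \<Rightarrow> ty \<Rightarrow> ty"
  and subst_tm :: "con \<Rightarrow> mor \<Rightarrow> tm \<Rightarrow> tm"
  and subst_mor :: "con \<Rightarrow> mor \<Rightarrow> mor \<Rightarrow> mor" where
  "subst_ty \<Gamma> \<gamma> Star = Star"
| "subst_ty \<Gamma> \<gamma> (Eq u T v) = Eq (subst_tm \<Gamma> \<gamma> u) (subst_ty \<Gamma> \<gamma> T) (subst_tm \<Gamma> \<gamma> v)"
| "subst_tm \<Gamma> \<gamma> (Var x) = sub_var \<Gamma> \<gamma> x"
| "subst_tm \<Gamma> \<gamma> (Coh \<Delta> T \<delta>) = Coh \<Delta> T (subst_mor \<Gamma> \<gamma> \<delta>)"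
| "subst_mor \<Gamma> \<gamma> MEmp = MEmp"
| "subst_mor \<Gamma> \<gamma> (MExt \<delta> u) = MExt (subst_mor \<Gamma> \<gamma> \<delta>) (subst_tm \<Gamma> \<gamma> u)"

text \<open>Every judgement in context \<open>\<Gamma>\<close> presupposes that \<open>\<Gamma>\<close> is a context; the rules without another
  premise in context \<open>\<Gamma>\<close> say so explicitly.\<close>

inductive con_ok :: "con \<Rightarrow> bool"
  and mor_ok :: "con \<Rightarrow> mor \<Rightarrow> con \<Rightarrow> bool"
  and ty_ok :: "con \<Rightarrow> ty \<Rightarrow> bool"
  and tm_ok :: "con \<Rightarrow> tm \<Rightarrow> ty \<Rightarrow> bool"
  and contractible :: "con \<Rightarrow> bool" where
  con_emp: "con_ok CEmp"
| con_ext: "ty_ok \<Gamma> T \<Longrightarrow> x \<notin> con_vars \<Gamma> \<Longrightarrow> con_ok (CExt \<Gamma> x T)"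
| mor_emp: "con_ok \<Gamma> \<Longrightarrow> mor_ok \<Gamma> MEmp CEmp"
| mor_ext: "ty_ok \<Gamma>' T \<Longrightarrow> mor_ok \<Gamma> \<gamma> \<Gamma>' \<Longrightarrow> tm_ok \<Gamma> u (subst_ty \<Gamma>' \<gamma> T) \<Longrightarrow> x \<notin> con_vars \<Gamma>' \<Longrightarrow>
    mor_ok \<Gamma> (MExt \<gamma> u) (CExt \<Gamma>' x T)"
| ty_star: "con_ok \<Gamma> \<Longrightarrow> ty_ok \<Gamma> Star"
| ty_eq: "tm_ok \<Gamma> u T \<Longrightarrow> tm_ok \<Gamma> v T \<Longrightarrow> ty_ok \<Gamma> (Eq u T v)"
| tm_variable: "con_ok \<Gamma> \<Longrightarrow> (x, T) \<in> con_entries \<Gamma> \<Longrightarrow> tm_ok \<Gamma> (Var x) T"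
| tm_coh: "contractible \<Delta> \<Longrightarrow> ty_ok \<Delta> T \<Longrightarrow> mor_ok \<Gamma> \<delta> \<Delta> \<Longrightarrow>
    tm_ok \<Gamma> (Coh \<Delta> T \<delta>) (subst_ty \<Delta> \<delta> T)"
| contr_base: "contractible (CExt CEmp x Star)"
| contr_ext: "contractible \<Delta> \<Longrightarrow> tm_ok \<Delta> u T \<Longrightarrow> y \<notin> con_vars \<Delta> \<Longrightarrow> z \<notin> con_vars \<Delta> \<Longrightarrow> y \<noteq> z \<Longrightarrow>
    contractible (CExt (CExt \<Delta> y T) z (Eq u T (Var y)))"

primrec depth_con :: "con \<Rightarrow> nat"
  and depth_ty :: "ty \<Rightarrow> nat"
  and depth_tm :: "tm \<Rightarrow> nat"
  and depth_mor :: "mor \<Rightarrow> nat" where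
  "depth_con CEmp = 0"
| "depth_con (CExt \<Gamma> x T) = max (depth_con \<Gamma>) (depth_ty T)"
| "depth_ty Star = 0"
| "depth_ty (Eq u T v) = max (depth_tm u) (max (depth_tm v) (depth_ty T))"
| "depth_tm (Var x) = 0"
| "depth_tm (Coh \<Delta> T \<delta>) = max (depth_mor \<delta>) (max (depth_ty T + 1) (depth_con \<Delta> + 1))"
| "depth_mor MEmp = 0"
| "depth_mor (MExt \<gamma> u) = max (depth_mor \<gamma>) (depth_tm u)"


section \<open>Weak \<open>\<infinity>\<close>-groupoids\<close>

text \<open>The coherence operations are collected in one function \<open>c\<close>, where \<open>c \<Delta> T\<close> is
  \<open>coh\<^sup>G\<^bsub>\<Delta>.T\<^esub>\<close>. The interpretation of an expression of depth at most \<open>n\<close> only involves \<open>c \<Delta> T\<close> with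
  \<open>max (depth_con \<Delta>) (depth_ty T) < n\<close>, so that it makes sense for an \<open>n\<close>-partial groupoid, for which the
  other values of \<open>c\<close> are irrelevant. The tuple \<open>(\<gamma>, a)\<close> is the list \<open>a # \<gamma>\<close>.\<close>

type_synonym 'c coherences = "con \<Rightarrow> ty \<Rightarrow> 'c list \<Rightarrow> 'c"

fun component :: "con \<Rightarrow> 'c list \<Rightarrow> var \<Rightarrow> 'c" where
  "component (CExt \<Gamma> y T) (a # \<gamma>) x = (if x = y then a else component \<Gamma> \<gamma> x)"
| "component _ _ _ = undefined"

primrec interp_ty :: "'c globular \<Rightarrow> 'c coherences \<Rightarrow> con \<Rightarrow> ty \<Rightarrow> 'c list \<Rightarrow> 'c globular"
  and interp_tm :: "'c globular \<Rightarrow> 'c coherences \<Rightarrow> con \<Rightarrow> tm \<Rightarrow> 'c list \<Rightarrow> 'c"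
  and interp_mor :: "'c globular \<Rightarrow> 'c coherences \<Rightarrow> con \<Rightarrow> mor \<Rightarrow> 'c list \<Rightarrow> 'c list" where
  "interp_ty G c \<Gamma> Star \<gamma> = G"
| "interp_ty G c \<Gamma> (Eq u T v) \<gamma> =
    Hom (interp_ty G c \<Gamma> T \<gamma>) (interp_tm G c \<Gamma> u \<gamma>) (interp_tm G c \<Gamma> v \<gamma>)"
| "interp_tm G c \<Gamma> (Var x) \<gamma> = component \<Gamma> \<gamma> x"
| "interp_tm G c \<Gamma> (Coh \<Delta> T \<delta>) \<gamma> = c \<Delta> T (interp_mor G c \<Gamma> \<delta> \<gamma>)"
| "interp_mor G c \<Gamma> MEmp \<gamma> = []"
| "interp_mor G c \<Gamma> (MExt \<theta> u) \<gamma> = interp_tm G c \<Gamma> u \<gamma> # interp_mor G c \<Gamma> \<theta> \<gamma>"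

primrec interp_con :: "'c globular \<Rightarrow> 'c coherences \<Rightarrow> con \<Rightarrow> 'c list set" where
  "interp_con G c CEmp = {[]}"
| "interp_con G c (CExt \<Gamma> x T) =
    {a # \<gamma> | \<gamma> a. \<gamma> \<in> interp_con G c \<Gamma> \<and> a \<in> Ob (interp_ty G c \<Gamma> T \<gamma>)}"

primrec partial_weak_groupoid :: "nat \<Rightarrow> 'c globular \<Rightarrow> 'c coherences \<Rightarrow> bool" where
  "partial_weak_groupoid 0 G c \<longleftrightarrow> globular_set G"
| "partial_weak_groupoid (Suc n) G c \<longleftrightarrow> partial_weak_groupoid n G c \<and>
    (\<forall>\<Delta> T. contractible \<Delta> \<longrightarrow> ty_ok \<Delta> T \<longrightarrow> max (depth_con \<Delta>) (depth_ty T) = n \<longrightarrow>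
      (\<forall>\<eta> \<in> interp_con G c \<Delta>. c \<Delta> T \<eta> \<in> Ob (interp_ty G c \<Delta> T \<eta>)))"

definition weak_infinity_groupoid :: "'c globular \<Rightarrow> 'c coherences \<Rightarrow> bool" where
  "weak_infinity_groupoid G c \<longleftrightarrow> (\<forall>n. partial_weak_groupoid n G c)"

end

theory Submission
  imports Defs
begin

text \<open>The coherence operations come from path induction. A contractible context is built from a point
  by repeatedly adjoining a variable \<open>y\<close> together with a path \<open>z : u \<simeq> y\<close>, and J eliminates such a
  pair: to inhabit a type over \<open>(\<Delta>, y, z)\<close> it suffices to inhabit its instance at \<open>y = u\<close> and
  \<open>z = refl u\<close>, which lives over \<open>\<Delta>\<close>. Repeating this, an inhabitant of a type \<open>T\<close> over a contractible
  \<open>\<Delta>\<close> is obtained from an inhabitant of an instance of \<open>T\<close> over the single point \<open>x : A\<close>.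

  What remains is to inhabit that last instance, and this is where the computation rule of J enters.
  A substitution into \<open>\<Delta>\<close> over \<open>x : A\<close> that sends every variable to an iterated reflexivity of \<open>x\<close>
  (\<open>collapse\<close>) sends every term, coherences included, to a term definitionally equal to an iterated
  reflexivity: a coherence was built by J, each J is evaluated at a reflexivity, and so the coherence
  computes to the term at the base point. Consequently every type collapses to the type of an iterated
  reflexivity, and that reflexivity is the inhabitant. Typing of the coherences and collapsing need
  each other, so they are proved by one induction on derivations (\<open>soundness\<close>, whose two substantial
  cases are \<open>coherent_ext\<close> and \<open>sound_coh\<close>).

  This yields an open term over the interpretation of \<open>\<Delta>\<close> in the type theory, because the motives of
  J have to be open types. The operation on cells substitutes the terms carried by the cells into it.
  A cell of an iterated hom of \<open>A\<^sup>G\<close> is a term of an iterated identity type together with the terms it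
  runs between, so a second induction (\<open>interpretation_ok\<close>) shows that the globular interpretation of
  every expression is its evaluation in the type theory, wrapped in its endpoints. The
  operations of all depths are defined at once, by recursion on expressions.\<close>

section \<open>Substitutions and the generic use of J\<close>

context dependent_type_theory
begin

lemma tm_sub_shift: "tm_sub M \<tau> (shift M k i) = \<tau> (i + k)"
  by (simp add: shift_def tm_sub_var)

lemma ty_sub_shift: "ty_sub M \<tau> (ty_sub M (shift M k) B) = ty_sub M (\<lambda>i. \<tau> (i + k)) B"
  by (simp add: ty_sub_comp tm_sub_shift)

lemma tm_sub_shift_tm: "tm_sub M \<tau> (tm_sub M (shift M k) t) = tm_sub M (\<lambda>i. \<tau> (i + k)) t"
  by (simp add: tm_sub_comp tm_sub_shift)

lemma var_type_Cons_0: "var_type M (B # \<Gamma>) 0 = ty_sub M (shift M 1) B"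
  by (simp add: var_type_def)

lemma var_type_Cons_Suc: "var_type M (B # \<Gamma>) (Suc i) = ty_sub M (shift M 1) (var_type M \<Gamma> i)"
  by (simp add: var_type_def ty_sub_shift shift_def ty_sub_comp tm_sub_var)

lemma is_subst_Cons:
  "is_subst M \<Delta> \<sigma> (B # \<Gamma>) \<longleftrightarrow> is_subst M \<Delta> (\<lambda>i. \<sigma> (Suc i)) \<Gamma> \<and> is_type M \<Gamma> B \<and>
     has_type M \<Delta> (\<sigma> 0) (ty_sub M (\<lambda>i. \<sigma> (Suc i)) B)"
  by (auto simp: is_subst_def All_less_Suc2 var_type_Cons_0 var_type_Cons_Suc ty_sub_shift)

lemma subst_eq_Cons:
  assumes "subst_eq M \<Delta> (\<lambda>i. \<sigma> (Suc i)) (\<lambda>i. \<tau> (Suc i)) \<Gamma>" and B: "is_type M \<Gamma> B"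
    and t: "term_eq M \<Delta> (\<sigma> 0) (\<tau> 0) (ty_sub M (\<lambda>i. \<sigma> (Suc i)) B)"
  shows "subst_eq M \<Delta> \<sigma> \<tau> (B # \<Gamma>)"
proof -
  have "type_eq M \<Delta> (ty_sub M (\<lambda>i. \<sigma> (Suc i)) B) (ty_sub M (\<lambda>i. \<tau> (Suc i)) B)"
    using assms(1) B type_eq_refl type_eq_sub by blast
  then have "has_type M \<Delta> (\<tau> 0) (ty_sub M (\<lambda>i. \<tau> (Suc i)) B)"
    using t term_eq_terms has_type_conv by blast
  moreover have "has_type M \<Delta> (\<sigma> 0) (ty_sub M (\<lambda>i. \<sigma> (Suc i)) B)"
    using t term_eq_terms by blast
  ultimately show ?thesis
    using assms
    by (auto simp: subst_eq_def is_subst_Cons All_less_Suc2 var_type_Cons_0 var_type_Cons_Suc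
        ty_sub_shift)
qed

lemma is_subst_id: "is_ctx M \<Gamma> \<Longrightarrow> is_subst M \<Gamma> (tm_var M) \<Gamma>"
  by (simp add: is_subst_def ty_sub_id has_type_var)

lemma is_subst_shift:
  assumes "is_ctx M (\<Delta> @ \<Gamma>)"
  shows "is_subst M (\<Delta> @ \<Gamma>) (shift M (length \<Delta>)) \<Gamma>"
proof -
  have "is_ctx M \<Gamma>"
    using assms by (induction \<Delta>) auto
  moreover have "has_type M (\<Delta> @ \<Gamma>) (shift M (length \<Delta>) i)
      (ty_sub M (shift M (length \<Delta>)) (var_type M \<Gamma> i))" if "i < length \<Gamma>" for i
  proof -
    have "has_type M (\<Delta> @ \<Gamma>) (tm_var M (i + length \<Delta>)) (var_type M (\<Delta> @ \<Gamma>) (i + length \<Delta>))"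
      by (rule has_type_var) (use assms that in auto)
    then show ?thesis
      by (simp add: var_type_def shift_def ty_sub_comp tm_sub_var nth_append add_ac)
  qed
  ultimately show ?thesis
    using assms by (simp add: is_subst_def)
qed

end

context type_theory_with_identity_types
begin

lemma ty_sub_cong: "(\<And>i. \<sigma> i = \<tau> i) \<Longrightarrow> ty_sub M \<sigma> P = ty_sub M \<tau> P"
  by presburger

lemma lift2:
  "lift_subst M (lift_subst M \<sigma>) =
     case_nat (tm_var M 0) (case_nat (tm_var M 1) (\<lambda>i. tm_sub M (shift M 2) (\<sigma> i)))"
  by (auto simp: lift_subst_def fun_eq_iff shift_def tm_sub_var tm_sub_comp split: nat.splits)

lemma ty_sub_inst2_lift2:
  "ty_sub M (inst2 M b q) (ty_sub M (lift_subst M (lift_subst M \<sigma>)) P) =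
     ty_sub M (case_nat q (case_nat b \<sigma>)) P"
  unfolding ty_sub_comp
  by (rule ty_sub_cong)
    (auto simp: lift2 inst2_def tm_sub_var tm_sub_shift_tm tm_sub_id numeral_2_eq_2
      split: nat.splits)

lemma ty_sub_inst2:
  "ty_sub M \<sigma> (ty_sub M (inst2 M b q) P) =
     ty_sub M (case_nat (tm_sub M \<sigma> q) (case_nat (tm_sub M \<sigma> b) \<sigma>)) P"
  unfolding ty_sub_comp
  by (rule ty_sub_cong) (auto simp: inst2_def tm_sub_var split: nat.splits)

lemma ty_sub_lift2_comp:
  "ty_sub M (lift_subst M (lift_subst M \<tau>)) (ty_sub M (lift_subst M (lift_subst M \<sigma>)) P) =
     ty_sub M (lift_subst M (lift_subst M (\<lambda>i. tm_sub M \<tau> (\<sigma> i)))) P"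
  unfolding ty_sub_comp
  by (rule ty_sub_cong)
    (auto simp: lift2 tm_sub_var tm_sub_shift tm_sub_comp split: nat.splits)

lemma is_ctx_J_ctx:
  assumes "has_type M \<Gamma> a B"
  shows "is_ctx M (J_ctx M \<Gamma> B a)"
proof -
  have B: "is_type M \<Gamma> B" and \<Gamma>: "is_ctx M \<Gamma>"
    using assms has_type_type is_type_ctx by blast+
  then have ctx: "is_ctx M (B # \<Gamma>)" by simp
  then have "is_subst M (B # \<Gamma>) (shift M 1) \<Gamma>"
    using is_subst_shift[of "[B]" \<Gamma>] by simp
  moreover have "has_type M (B # \<Gamma>) (tm_var M 0) (ty_sub M (shift M 1) B)"
    using has_type_var[OF ctx, of 0] by (simp add: var_type_Cons_0)
  ultimately show ?thesis
    using assms ctx by (auto simp: J_ctx_def intro: Id_form has_type_sub)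
qed

lemma is_subst_J_ctx:
  assumes a: "has_type M \<Gamma> a B" and \<sigma>: "is_subst M \<Delta> \<sigma> \<Gamma>"
    and b: "has_type M \<Delta> b (ty_sub M \<sigma> B)"
    and q: "has_type M \<Delta> q (Id_ty M (ty_sub M \<sigma> B) (tm_sub M \<sigma> a) b)"
  shows "is_subst M \<Delta> (case_nat q (case_nat b \<sigma>)) (J_ctx M \<Gamma> B a)"
  using assms is_ctx_J_ctx[OF a]
  by (auto simp: J_ctx_def is_subst_Cons Id_sub ty_sub_shift tm_sub_shift_tm tm_sub_var)

lemma J_ctx_vars:
  assumes "has_type M \<Gamma> a B"
  shows "is_subst M (J_ctx M \<Gamma> B a) (shift M 2) \<Gamma>"
    and "has_type M (J_ctx M \<Gamma> B a) (tm_var M 1) (ty_sub M (shift M 2) B)"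
    and "has_type M (J_ctx M \<Gamma> B a) (tm_var M 0)
      (Id_ty M (ty_sub M (shift M 2) B) (tm_sub M (shift M 2) a) (tm_var M 1))"
proof -
  note ctx = is_ctx_J_ctx[OF assms]
  show "is_subst M (J_ctx M \<Gamma> B a) (shift M 2) \<Gamma>"
    using is_subst_shift[of "[_, _]" \<Gamma>] ctx by (simp add: J_ctx_def numeral_2_eq_2)
  have sh: "(\<lambda>i. shift M (Suc 0) (Suc i)) = shift M 2" "(\<lambda>i. shift M (Suc 0) (i + Suc 0)) = shift M 2"
    by (simp_all add: shift_def fun_eq_iff)
  show "has_type M (J_ctx M \<Gamma> B a) (tm_var M 1) (ty_sub M (shift M 2) B)"
    using has_type_var[OF ctx, of 1]
    by (simp add: J_ctx_def var_type_Cons_0 var_type_Cons_Suc ty_sub_shift sh)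
  show "has_type M (J_ctx M \<Gamma> B a) (tm_var M 0)
      (Id_ty M (ty_sub M (shift M 2) B) (tm_sub M (shift M 2) a) (tm_var M 1))"
    using has_type_var[OF ctx, of 0]
    by (simp add: J_ctx_def var_type_Cons_0 Id_sub ty_sub_shift tm_sub_shift_tm tm_sub_var sh)
      (simp add: shift_def)
qed

lemma is_subst_lift2:
  assumes a: "has_type M \<Gamma> a B" and \<sigma>: "is_subst M \<Delta> \<sigma> \<Gamma>"
  shows "is_subst M (J_ctx M \<Delta> (ty_sub M \<sigma> B) (tm_sub M \<sigma> a)) (lift_subst M (lift_subst M \<sigma>))
    (J_ctx M \<Gamma> B a)"
proof -
  have a': "has_type M \<Delta> (tm_sub M \<sigma> a) (ty_sub M \<sigma> B)"
    using a \<sigma> has_type_sub by blast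
  let ?\<Delta> = "J_ctx M \<Delta> (ty_sub M \<sigma> B) (tm_sub M \<sigma> a)"
  note V = J_ctx_vars[OF a']
  have "is_subst M ?\<Delta> (\<lambda>i. tm_sub M (shift M 2) (\<sigma> i)) \<Gamma>"
    using \<sigma> V(1) has_type_sub[OF V(1)] by (auto simp: is_subst_def simp flip: ty_sub_comp)
  then show ?thesis
    unfolding lift2 using a V(2,3) by (intro is_subst_J_ctx) (auto simp: ty_sub_comp tm_sub_comp)
qed

text \<open>J applied to the two generic variables of its motive, so that eliminating the last two variables
  of a context takes a term over the shorter context to a term over the longer one.\<close>

definition generic_J :: "'T \<Rightarrow> 't \<Rightarrow> 'T \<Rightarrow> 't \<Rightarrow> 't" where
  "generic_J B a P d =
     J_tm M (ty_sub M (shift M 2) B) (tm_sub M (shift M 2) a)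
       (ty_sub M (lift_subst M (lift_subst M (shift M 2))) P) (tm_sub M (shift M 2) d)
       (tm_var M 1) (tm_var M 0)"

lemma generic_J_type:
  assumes a: "has_type M \<Gamma> a B" and P: "is_type M (J_ctx M \<Gamma> B a) P"
    and d: "has_type M \<Gamma> d (ty_sub M (inst2 M a (refl_tm M B a)) P)"
  shows "has_type M (J_ctx M \<Gamma> B a) (generic_J B a P d) P"
proof -
  note V = J_ctx_vars[OF a]
  let ?w = "shift M 2" and ?\<Delta> = "J_ctx M \<Gamma> B a"
  let ?P = "ty_sub M (lift_subst M (lift_subst M ?w)) P"
  have "is_type M (J_ctx M ?\<Delta> (ty_sub M ?w B) (tm_sub M ?w a)) ?P"
    using is_subst_lift2[OF a V(1)] P is_type_sub by blast
  moreover have "has_type M ?\<Delta> (tm_sub M ?w d)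
      (ty_sub M (inst2 M (tm_sub M ?w a) (refl_tm M (ty_sub M ?w B) (tm_sub M ?w a))) ?P)"
    using has_type_sub[OF V(1) d] by (simp add: ty_sub_inst2_lift2 ty_sub_inst2 refl_sub)
  moreover have "has_type M ?\<Delta> (tm_sub M ?w a) (ty_sub M ?w B)"
    using has_type_sub[OF V(1) a] .
  ultimately have "has_type M ?\<Delta> (generic_J B a P d)
      (ty_sub M (inst2 M (tm_var M 1) (tm_var M 0)) ?P)"
    unfolding generic_J_def using V(2,3) by (intro J_elim) auto
  moreover have "case_nat (tm_var M 0) (case_nat (tm_var M 1) ?w) = tm_var M"
    by (auto simp: fun_eq_iff shift_def split: nat.splits)
  ultimately show ?thesis
    by (simp add: ty_sub_inst2_lift2 ty_sub_id)
qed

text \<open>The substitution \<open>\<rho>\<close> sends the path variable to a reflexivity, so that J computes.\<close>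

lemma generic_J_comp:
  assumes a: "has_type M \<Gamma> a B" and P: "is_type M (J_ctx M \<Gamma> B a) P"
    and d: "has_type M \<Gamma> d (ty_sub M (inst2 M a (refl_tm M B a)) P)"
    and \<sigma>: "is_subst M \<Delta> \<sigma> \<Gamma>"
  defines "\<rho> \<equiv> case_nat (tm_sub M \<sigma> (refl_tm M B a)) (case_nat (tm_sub M \<sigma> a) \<sigma>)"
  shows "term_eq M \<Delta> (tm_sub M \<rho> (generic_J B a P d)) (tm_sub M \<sigma> d) (ty_sub M \<rho> P)"
proof -
  let ?B = "ty_sub M \<sigma> B" and ?a = "tm_sub M \<sigma> a"
  let ?P = "ty_sub M (lift_subst M (lift_subst M \<sigma>)) P"
  have P': "ty_sub M (inst2 M ?a (refl_tm M ?B ?a)) ?P = ty_sub M \<rho> P"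
    by (simp add: ty_sub_inst2_lift2 \<rho>_def refl_sub)
  have "is_type M (J_ctx M \<Delta> ?B ?a) ?P"
    using is_subst_lift2[OF a \<sigma>] P is_type_sub by blast
  moreover have "has_type M \<Delta> (tm_sub M \<sigma> d) (ty_sub M (inst2 M ?a (refl_tm M ?B ?a)) ?P)"
    using has_type_sub[OF \<sigma> d] by (simp add: ty_sub_inst2_lift2 ty_sub_inst2 refl_sub)
  ultimately have "term_eq M \<Delta> (J_tm M ?B ?a ?P (tm_sub M \<sigma> d) ?a (refl_tm M ?B ?a))
      (tm_sub M \<sigma> d) (ty_sub M (inst2 M ?a (refl_tm M ?B ?a)) ?P)"
    using has_type_sub[OF \<sigma> a] by (intro J_comp)
  moreover have "tm_sub M \<rho> (generic_J B a P d) =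
      J_tm M ?B ?a ?P (tm_sub M \<sigma> d) ?a (refl_tm M ?B ?a)"
    by (simp add: generic_J_def J_sub ty_sub_shift tm_sub_shift_tm ty_sub_lift2_comp tm_sub_shift
        tm_sub_var \<rho>_def refl_sub)
  ultimately show ?thesis
    by (simp add: P')
qed

end

section \<open>Evaluating expressions of \<open>T\<^sub>\<infinity>\<close> in the identity types of \<open>A\<close>\<close>

lemma con_induct [case_names CEmp CExt]:
  assumes "P CEmp" "\<And>\<Gamma> x T. P \<Gamma> \<Longrightarrow> P (CExt \<Gamma> x T)"
  shows "P \<Gamma>"
  by (rule con.induct[of P "\<lambda>_. True" "\<lambda>_. True" "\<lambda>_. True"]) (simp_all add: assms)

lemma ty_induct [case_names Star Eq]:
  assumes "P Star" "\<And>u T v. P T \<Longrightarrow> P (Eq u T v)"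
  shows "P T"
  by (rule ty.induct[of "\<lambda>_. True" P "\<lambda>_. True" "\<lambda>_. True"]) (simp_all add: assms)

lemma mor_induct [case_names MEmp MExt]:
  assumes "P MEmp" "\<And>\<delta> u. P \<delta> \<Longrightarrow> P (MExt \<delta> u)"
  shows "P \<delta>"
  by (rule mor.induct[of "\<lambda>_. True" "\<lambda>_. True" "\<lambda>_. True" P]) (simp_all add: assms)

primrec ty_dim :: "ty \<Rightarrow> nat" where
  "ty_dim Star = 0"
| "ty_dim (Eq u T v) = Suc (ty_dim T)"

lemma ty_dim_subst: "ty_dim (subst_ty \<Gamma> \<gamma> T) = ty_dim T"
  by (induction T rule: ty_induct) auto

primrec var_index :: "con \<Rightarrow> var \<Rightarrow> nat" where
  "var_index CEmp x = 0"
| "var_index (CExt \<Gamma> y T) x = (if x = y then 0 else Suc (var_index \<Gamma> x))"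

primrec mor_length :: "mor \<Rightarrow> nat" where
  "mor_length MEmp = 0"
| "mor_length (MExt \<delta> u) = Suc (mor_length \<delta>)"

text \<open>Beyond the end of the list the value is the last entry, because then every function applied to the
  entries commutes with \<open>list_subst\<close> exactly, and not only below the length. The arguments of
  coherences are never empty, since contractible contexts are not.\<close>

definition list_subst :: "'a list \<Rightarrow> nat \<Rightarrow> 'a" where
  "list_subst ts i = (if i < length ts then ts ! i else last ts)"

lemma list_subst_map: "ts \<noteq> [] \<Longrightarrow> list_subst (map f ts) i = f (list_subst ts i)"
  by (simp add: list_subst_def last_map)

lemma list_subst_Cons_0 [simp]: "list_subst (t # ts) 0 = t"
  by (simp add: list_subst_def)

text \<open>The argument of a coherence is required to be nonempty for the sake of \<open>list_subst_map\<close>; its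
  subscript has no free variables.\<close>

primrec scoped_ty :: "var set \<Rightarrow> ty \<Rightarrow> bool"
  and scoped_tm :: "var set \<Rightarrow> tm \<Rightarrow> bool"
  and scoped_mor :: "var set \<Rightarrow> mor \<Rightarrow> bool" where
  "scoped_ty V Star = True"
| "scoped_ty V (Eq u T v) = (scoped_tm V u \<and> scoped_ty V T \<and> scoped_tm V v)"
| "scoped_tm V (Var x) = (x \<in> V)"
| "scoped_tm V (Coh \<Delta> T \<delta>) = (\<delta> \<noteq> MEmp \<and> scoped_mor V \<delta>)"
| "scoped_mor V MEmp = True"
| "scoped_mor V (MExt \<delta> u) = (scoped_mor V \<delta> \<and> scoped_tm V u)"

locale closed_type = type_theory_with_identity_types M for M :: "('T, 't) type_theory" +
  fixes A :: 'T
  assumes closed: "is_type M [] A"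
begin

text \<open>The iterated reflexivities of the variable \<open>0\<close> over the context \<open>[A]\<close>, and their types.\<close>

fun loop_ty :: "nat \<Rightarrow> 'T" and loop_tm :: "nat \<Rightarrow> 't" where
  "loop_ty 0 = A"
| "loop_ty (Suc k) = Id_ty M (loop_ty k) (loop_tm k) (loop_tm k)"
| "loop_tm 0 = tm_var M 0"
| "loop_tm (Suc k) = refl_tm M (loop_ty k) (loop_tm k)"

text \<open>Variables are evaluated by an environment instead of being translated to indices, so that both
  substitution in \<open>T\<^sub>\<infinity>\<close> and substitution in the type theory become changes of environment
  (\<open>val_subst\<close> and \<open>val_sub\<close>).

  In \<open>coherence \<Delta> k P\<close> the type \<open>P\<close> over the interpretation of \<open>\<Delta>\<close> is the motive, and \<open>k\<close> is the
  number of reflexivities onto which it collapses. It is passed along because \<open>P\<close> changes in the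
  recursion and its shape cannot be inspected; over the one-variable context \<open>P\<close> is then only known to
  be definitionally equal to \<open>loop_ty k\<close>.\<close>

fun val_ty :: "(var \<Rightarrow> 't) \<Rightarrow> ty \<Rightarrow> 'T"
  and val_tm :: "(var \<Rightarrow> 't) \<Rightarrow> tm \<Rightarrow> 't"
  and val_mor :: "(var \<Rightarrow> 't) \<Rightarrow> mor \<Rightarrow> 't list"
  and coherence :: "con \<Rightarrow> nat \<Rightarrow> 'T \<Rightarrow> 't" where
  "val_ty e Star = A"
| "val_ty e (Eq u T v) = Id_ty M (val_ty e T) (val_tm e u) (val_tm e v)"
| "val_tm e (Var x) = e x"
| "val_tm e (Coh \<Delta> T \<delta>) =
     tm_sub M (list_subst (val_mor e \<delta>))
       (coherence \<Delta> (ty_dim T) (val_ty (\<lambda>x. tm_var M (var_index \<Delta> x)) T))"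
| "val_mor e MEmp = []"
| "val_mor e (MExt \<delta> u) = val_tm e u # val_mor e \<delta>"
| "coherence (CExt (CExt \<Delta> y T) z (Eq u S v)) k P =
     (let B = val_ty (\<lambda>x. tm_var M (var_index \<Delta> x)) T;
          a = val_tm (\<lambda>x. tm_var M (var_index \<Delta> x)) u
      in generic_J B a P (coherence \<Delta> k (ty_sub M (inst2 M a (refl_tm M B a)) P)))"
| "coherence _ k P = loop_tm k"

abbreviation open_ty :: "con \<Rightarrow> ty \<Rightarrow> 'T" where
  "open_ty \<Gamma> T \<equiv> val_ty (\<lambda>x. tm_var M (var_index \<Gamma> x)) T"

abbreviation open_tm :: "con \<Rightarrow> tm \<Rightarrow> 't" where
  "open_tm \<Gamma> u \<equiv> val_tm (\<lambda>x. tm_var M (var_index \<Gamma> x)) u"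

primrec val_con :: "con \<Rightarrow> 'T list" where
  "val_con CEmp = []"
| "val_con (CExt \<Gamma> x T) = open_ty \<Gamma> T # val_con \<Gamma>"

lemma A_sub: "ty_sub M \<sigma> A = A"
  using ty_scope[OF closed, of \<sigma> "tm_var M"] by (simp add: ty_sub_id)

lemma length_val_mor [simp]: "length (val_mor e \<delta>) = mor_length \<delta>"
  by (induction \<delta> rule: mor_induct) auto

lemma val_mor_eq_Nil [simp]: "val_mor e \<delta> = [] \<longleftrightarrow> \<delta> = MEmp"
  by (cases \<delta>) auto

text \<open>Here and below, a first conclusion \<open>True\<close> is the component for contexts of the structural
  induction on expressions: contexts occur only in subscripts, which are closed.\<close>

lemma val_cong:
  "True"
  "scoped_ty V T \<Longrightarrow> (\<And>x. x \<in> V \<Longrightarrow> e x = e' x) \<Longrightarrow> val_ty e T = val_ty e' T"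
  "scoped_tm V u \<Longrightarrow> (\<And>x. x \<in> V \<Longrightarrow> e x = e' x) \<Longrightarrow> val_tm e u = val_tm e' u"
  "scoped_mor V \<delta> \<Longrightarrow> (\<And>x. x \<in> V \<Longrightarrow> e x = e' x) \<Longrightarrow> val_mor e \<delta> = val_mor e' \<delta>"
  for \<Gamma> :: con
  by (induction \<Gamma> and T and u and \<delta>) auto

lemma val_sub:
  "True"
  "scoped_ty V T \<Longrightarrow> ty_sub M \<sigma> (val_ty e T) = val_ty (\<lambda>x. tm_sub M \<sigma> (e x)) T"
  "scoped_tm V u \<Longrightarrow> tm_sub M \<sigma> (val_tm e u) = val_tm (\<lambda>x. tm_sub M \<sigma> (e x)) u"
  "scoped_mor V \<delta> \<Longrightarrow> map (tm_sub M \<sigma>) (val_mor e \<delta>) = val_mor (\<lambda>x. tm_sub M \<sigma> (e x)) \<delta>"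
  for \<Gamma> :: con
proof (induction \<Gamma> and T and u and \<delta>)
  case (Coh \<Delta> T \<delta>)
  then have "tm_sub M \<sigma> (list_subst (val_mor e \<delta>) i) =
      list_subst (val_mor (\<lambda>x. tm_sub M \<sigma> (e x)) \<delta>) i" for i
    by (metis list_subst_map val_mor_eq_Nil scoped_tm.simps(2))
  then show ?case
    by (simp add: tm_sub_comp)
qed (auto simp: A_sub Id_sub)

lemma val_subst:
  "True"
  "val_ty e (subst_ty \<Gamma> \<gamma> T) = val_ty (\<lambda>x. val_tm e (sub_var \<Gamma> \<gamma> x)) T"
  "val_tm e (subst_tm \<Gamma> \<gamma> u) = val_tm (\<lambda>x. val_tm e (sub_var \<Gamma> \<gamma> x)) u"
  "val_mor e (subst_mor \<Gamma> \<gamma> \<delta>) = val_mor (\<lambda>x. val_tm e (sub_var \<Gamma> \<gamma> x)) \<delta>"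
  for \<Delta> :: con
  by (induction \<Delta> and T and u and \<delta>) auto

end

lemma scoped_mono:
  "True"
  "scoped_ty V T \<Longrightarrow> V \<subseteq> W \<Longrightarrow> scoped_ty W T"
  "scoped_tm V u \<Longrightarrow> V \<subseteq> W \<Longrightarrow> scoped_tm W u"
  "scoped_mor V \<delta> \<Longrightarrow> V \<subseteq> W \<Longrightarrow> scoped_mor W \<delta>"
  for \<Gamma> :: con
  by (induction \<Gamma> and T and u and \<delta>) auto

lemma subst_mor_eq_MEmp [simp]: "subst_mor \<Gamma> \<gamma> \<delta> = MEmp \<longleftrightarrow> \<delta> = MEmp"
  by (cases \<delta>) auto

lemma scoped_subst:
  "True"
  "scoped_ty V T \<Longrightarrow> (\<And>x. x \<in> V \<Longrightarrow> scoped_tm W (sub_var \<Gamma> \<gamma> x)) \<Longrightarrow> scoped_ty W (subst_ty \<Gamma> \<gamma> T)"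
  "scoped_tm V u \<Longrightarrow> (\<And>x. x \<in> V \<Longrightarrow> scoped_tm W (sub_var \<Gamma> \<gamma> x)) \<Longrightarrow> scoped_tm W (subst_tm \<Gamma> \<gamma> u)"
  "scoped_mor V \<delta> \<Longrightarrow> (\<And>x. x \<in> V \<Longrightarrow> scoped_tm W (sub_var \<Gamma> \<gamma> x)) \<Longrightarrow> scoped_mor W (subst_mor \<Gamma> \<gamma> \<delta>)"
  for \<Delta> :: con
  by (induction \<Delta> and T and u and \<delta>) auto

lemma con_vars_simps [simp]: "con_vars CEmp = {}" "con_vars (CExt \<Gamma> x T) = insert x (con_vars \<Gamma>)"
  by (auto simp: con_vars_def)

lemma scoped_sub_var:
  "mor_ok \<Gamma> \<delta> \<Delta> \<Longrightarrow> scoped_mor V \<delta> \<Longrightarrow> x \<in> con_vars \<Delta> \<Longrightarrow> scoped_tm V (sub_var \<Delta> \<delta> x)"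
  by (induction \<Delta> \<delta> x rule: sub_var.induct) (auto elim: mor_ok.cases)

lemma contractible_nonempty: "\<not> contractible CEmp"
  by (auto elim: contractible.cases)

lemma mor_ok_nonempty: "mor_ok \<Gamma> \<delta> \<Delta> \<Longrightarrow> contractible \<Delta> \<Longrightarrow> \<delta> \<noteq> MEmp"
  using contractible_nonempty by (auto elim: mor_ok.cases)

text \<open>The part of well-formedness that concerns variables, which governs evaluation under a changed
  environment.\<close>

primrec wf_con :: "con \<Rightarrow> bool" where
  "wf_con CEmp = True"
| "wf_con (CExt \<Gamma> x T) = (wf_con \<Gamma> \<and> x \<notin> con_vars \<Gamma> \<and> scoped_ty (con_vars \<Gamma>) T)"

lemma entry_scoped:
  assumes "wf_con \<Gamma>" "(x, T) \<in> con_entries \<Gamma>"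
  shows "x \<in> con_vars \<Gamma>" "scoped_ty (con_vars \<Gamma>) T"
  using assms by (induction \<Gamma> rule: con_induct) (auto intro: scoped_mono(2))

lemma typed_scoped:
  "con_ok \<Gamma> \<Longrightarrow> wf_con \<Gamma>"
  "mor_ok \<Gamma> \<delta> \<Delta> \<Longrightarrow> wf_con \<Gamma> \<and> scoped_mor (con_vars \<Gamma>) \<delta>"
  "ty_ok \<Gamma> T \<Longrightarrow> wf_con \<Gamma> \<and> scoped_ty (con_vars \<Gamma>) T"
  "tm_ok \<Gamma> u T \<Longrightarrow> wf_con \<Gamma> \<and> scoped_tm (con_vars \<Gamma>) u \<and> scoped_ty (con_vars \<Gamma>) T"
  "contractible \<Delta> \<Longrightarrow> wf_con \<Delta>"
proof (induction rule: con_ok_mor_ok_ty_ok_tm_ok_contractible.inducts)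
  case (tm_coh \<Delta> T \<Gamma> \<delta>)
  then show ?case
    using scoped_sub_var[OF tm_coh.hyps(3)] mor_ok_nonempty by (auto intro!: scoped_subst(2))
qed (auto simp: entry_scoped intro: scoped_mono(2,3))

context closed_type
begin

lemma list_subst_val_mor:
  "mor_ok \<Gamma> \<delta> \<Delta> \<Longrightarrow> x \<in> con_vars \<Delta> \<Longrightarrow>
     list_subst (val_mor e \<delta>) (var_index \<Delta> x) = val_tm e (sub_var \<Delta> \<delta> x)"
proof (induction \<Delta> \<delta> x rule: sub_var.induct)
  case (1 \<Delta> y T \<delta> u x)
  then have \<delta>: "mor_ok \<Gamma> \<delta> \<Delta>"
    by (auto elim: mor_ok.cases)
  show ?case
  proof (cases "x = y")
    case False
    then have "x \<in> con_vars \<Delta>"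
      using 1 by simp
    moreover from this have "\<delta> \<noteq> MEmp"
      using \<delta> by (auto elim: mor_ok.cases)
    ultimately show ?thesis
      using 1 \<delta> False by (auto simp: list_subst_def)
  qed simp
qed (auto elim: mor_ok.cases)

lemma val_ty_subst:
  assumes "mor_ok \<Gamma> \<delta> \<Delta>" "scoped_ty (con_vars \<Delta>) T"
  shows "val_ty e (subst_ty \<Delta> \<delta> T) = val_ty (\<lambda>x. list_subst (val_mor e \<delta>) (var_index \<Delta> x)) T"
  unfolding val_subst(2) using assms by (intro val_cong(2)) (auto simp: list_subst_val_mor)

lemma val_weaken:
  assumes "x \<notin> con_vars \<Gamma>"
  shows "scoped_ty (con_vars \<Gamma>) T \<Longrightarrow>
      val_ty (\<lambda>y. \<sigma> (var_index (CExt \<Gamma> x S) y)) T = val_ty (\<lambda>y. \<sigma> (Suc (var_index \<Gamma> y))) T"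
    and "scoped_tm (con_vars \<Gamma>) u \<Longrightarrow>
      val_tm (\<lambda>y. \<sigma> (var_index (CExt \<Gamma> x S) y)) u = val_tm (\<lambda>y. \<sigma> (Suc (var_index \<Gamma> y))) u"
  using assms by (auto intro!: val_cong(2,3)[where V = "con_vars \<Gamma>"])

section \<open>Collapsing onto the iterated reflexivities\<close>

definition collapse :: "(nat \<Rightarrow> 't) \<Rightarrow> con \<Rightarrow> bool" where
  "collapse \<sigma> \<Gamma> \<longleftrightarrow> (\<forall>(x, T) \<in> con_entries \<Gamma>.
     term_eq M [A] (\<sigma> (var_index \<Gamma> x)) (loop_tm (ty_dim T)) (loop_ty (ty_dim T)))"

text \<open>Each judgement is interpreted by a pair: typing over the interpreted context, and behaviour under
  collapse. The second half is what the first needs at the base of the recursion of \<open>coherence\<close>.\<close>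

definition sound_ty :: "con \<Rightarrow> ty \<Rightarrow> bool" where
  "sound_ty \<Gamma> T \<longleftrightarrow> is_type M (val_con \<Gamma>) (open_ty \<Gamma> T) \<and>
     (\<forall>\<sigma>. collapse \<sigma> \<Gamma> \<longrightarrow>
        type_eq M [A] (val_ty (\<lambda>x. \<sigma> (var_index \<Gamma> x)) T) (loop_ty (ty_dim T)))"

definition sound_tm :: "con \<Rightarrow> tm \<Rightarrow> ty \<Rightarrow> bool" where
  "sound_tm \<Gamma> u T \<longleftrightarrow> has_type M (val_con \<Gamma>) (open_tm \<Gamma> u) (open_ty \<Gamma> T) \<and>
     (\<forall>\<sigma>. collapse \<sigma> \<Gamma> \<longrightarrow>
        term_eq M [A] (val_tm (\<lambda>x. \<sigma> (var_index \<Gamma> x)) u) (loop_tm (ty_dim T)) (loop_ty (ty_dim T)))"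

definition sound_mor :: "con \<Rightarrow> mor \<Rightarrow> con \<Rightarrow> bool" where
  "sound_mor \<Gamma> \<delta> \<Delta> \<longleftrightarrow>
     is_subst M (val_con \<Gamma>) (list_subst (val_mor (\<lambda>x. tm_var M (var_index \<Gamma> x)) \<delta>)) (val_con \<Delta>) \<and>
     (\<forall>\<sigma>. collapse \<sigma> \<Gamma> \<longrightarrow> collapse (list_subst (val_mor (\<lambda>x. \<sigma> (var_index \<Gamma> x)) \<delta>)) \<Delta>)"

primrec sound_con :: "con \<Rightarrow> bool" where
  "sound_con CEmp = True"
| "sound_con (CExt \<Gamma> x T) = (sound_con \<Gamma> \<and> sound_ty \<Gamma> T)"

text \<open>One collapsing substitution is enough, as any two are definitionally equal
  (\<open>collapse_unique\<close>). It can thus be chosen to send path variables to literal reflexivities, to which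
  the computation rule of J applies directly.\<close>

definition coherent :: "con \<Rightarrow> bool" where
  "coherent \<Delta> \<longleftrightarrow> (\<exists>\<rho>. collapse \<rho> \<Delta> \<and>
     (\<forall>P k. is_type M (val_con \<Delta>) P \<longrightarrow> type_eq M [A] (ty_sub M \<rho> P) (loop_ty k) \<longrightarrow>
        has_type M (val_con \<Delta>) (coherence \<Delta> k P) P \<and>
        term_eq M [A] (tm_sub M \<rho> (coherence \<Delta> k P)) (loop_tm k) (loop_ty k)))"

lemma loop_typed: "has_type M [A] (loop_tm k) (loop_ty k)"
proof (induction k)
  case 0
  show ?case
    using has_type_var[of "[A]" 0] closed by (simp add: var_type_def A_sub)
qed (auto intro: refl_intro)

lemma collapse_CExt:
  assumes "x \<notin> con_vars \<Gamma>"
  shows "collapse \<sigma> (CExt \<Gamma> x T) \<longleftrightarrow> collapse (\<lambda>i. \<sigma> (Suc i)) \<Gamma> \<and>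
    term_eq M [A] (\<sigma> 0) (loop_tm (ty_dim T)) (loop_ty (ty_dim T))"
proof -
  have "y \<noteq> x" if "(y, S) \<in> con_entries \<Gamma>" for y S
    using assms that by (force simp: con_vars_def)
  then show ?thesis
    by (fastforce simp: collapse_def)
qed

lemma sound_con_is_ctx: "sound_con \<Gamma> \<Longrightarrow> is_ctx M (val_con \<Gamma>)"
  by (induction \<Gamma> rule: con_induct) (auto simp: sound_ty_def)

lemma open_sub:
  assumes "scoped_ty V T"
  shows "ty_sub M \<sigma> (open_ty \<Gamma> T) = val_ty (\<lambda>x. \<sigma> (var_index \<Gamma> x)) T"
  using val_sub(2)[OF assms, of \<sigma> "\<lambda>x. tm_var M (var_index \<Gamma> x)"] by (simp add: tm_sub_var)

lemma open_sub_tm: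
  assumes "scoped_tm V u"
  shows "tm_sub M \<sigma> (open_tm \<Gamma> u) = val_tm (\<lambda>x. \<sigma> (var_index \<Gamma> x)) u"
  using val_sub(3)[OF assms, of \<sigma> "\<lambda>x. tm_var M (var_index \<Gamma> x)"] by (simp add: tm_sub_var)

text \<open>Both substitutions send a variable to the same iterated reflexivity, up to definitional equality;
  its type collapses as well, so the equality holds at the type that a substitution must respect.\<close>

lemma collapse_unique:
  "wf_con \<Gamma> \<Longrightarrow> sound_con \<Gamma> \<Longrightarrow> collapse \<sigma> \<Gamma> \<Longrightarrow> collapse \<tau> \<Gamma> \<Longrightarrow>
     subst_eq M [A] \<sigma> \<tau> (val_con \<Gamma>)"
proof (induction \<Gamma> arbitrary: \<sigma> \<tau> rule: con_induct)
  case CEmp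
  then show ?case
    using closed by (simp add: subst_eq_def is_subst_def)
next
  case (CExt \<Gamma> x T)
  let ?R = "loop_ty (ty_dim T)"
  have c: "collapse (\<lambda>i. \<sigma> (Suc i)) \<Gamma>" "collapse (\<lambda>i. \<tau> (Suc i)) \<Gamma>"
    and t: "term_eq M [A] (\<sigma> 0) (\<tau> 0) ?R"
    using CExt.prems by (auto simp: collapse_CExt intro: term_eq_trans term_eq_sym)
  have "type_eq M [A] (val_ty (\<lambda>x. \<sigma> (Suc (var_index \<Gamma> x))) T) ?R"
    using c(1) CExt.prems(2) unfolding sound_con.simps sound_ty_def by blast
  then have "type_eq M [A] ?R (ty_sub M (\<lambda>i. \<sigma> (Suc i)) (open_ty \<Gamma> T))"
    using CExt.prems(1) by (auto simp: open_sub[of "con_vars \<Gamma>"] type_eq_sym)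
  then show ?case
    using CExt c t by (auto intro!: subst_eq_Cons simp: sound_ty_def intro: term_eq_conv)
qed

lemma open_weaken:
  assumes "wf_con (CExt \<Gamma> x S)"
  shows "scoped_ty (con_vars \<Gamma>) T \<Longrightarrow>
      open_ty (CExt \<Gamma> x S) T = ty_sub M (shift M 1) (open_ty \<Gamma> T)"
    and "scoped_tm (con_vars \<Gamma>) u \<Longrightarrow>
      open_tm (CExt \<Gamma> x S) u = tm_sub M (shift M 1) (open_tm \<Gamma> u)"
  using assms by (auto simp: val_weaken open_sub open_sub_tm shift_def simp del: var_index.simps)

lemma sound_ty_weaken:
  assumes "wf_con (CExt \<Gamma> x S)" "sound_con (CExt \<Gamma> x S)" "scoped_ty (con_vars \<Gamma>) T" "sound_ty \<Gamma> T"
  shows "sound_ty (CExt \<Gamma> x S) T"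
  using assms is_subst_shift[of "[open_ty \<Gamma> S]" "val_con \<Gamma>"] sound_con_is_ctx[OF assms(2)]
  by (auto simp: sound_ty_def open_weaken val_weaken collapse_CExt simp del: var_index.simps
      intro: is_type_sub)

lemma sound_tm_weaken:
  assumes "wf_con (CExt \<Gamma> x S)" "sound_con (CExt \<Gamma> x S)" "scoped_ty (con_vars \<Gamma>) T"
    "scoped_tm (con_vars \<Gamma>) u" "sound_tm \<Gamma> u T"
  shows "sound_tm (CExt \<Gamma> x S) u T"
  using assms is_subst_shift[of "[open_ty \<Gamma> S]" "val_con \<Gamma>"] sound_con_is_ctx[OF assms(2)]
  by (auto simp: sound_tm_def open_weaken val_weaken collapse_CExt simp del: var_index.simps
      intro: has_type_sub)

lemma sound_var_0:
  assumes "wf_con (CExt \<Gamma> x T)" "sound_con (CExt \<Gamma> x T)"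
  shows "sound_tm (CExt \<Gamma> x T) (Var x) T"
  using assms has_type_var[of "val_con (CExt \<Gamma> x T)" 0] sound_con_is_ctx[OF assms(2)]
  by (auto simp: sound_tm_def open_weaken collapse_CExt var_type_Cons_0)
     (simp add: open_weaken[OF assms(1), simplified])

lemma sound_var:
  "wf_con \<Gamma> \<Longrightarrow> sound_con \<Gamma> \<Longrightarrow> (x, T) \<in> con_entries \<Gamma> \<Longrightarrow> sound_ty \<Gamma> T \<and> sound_tm \<Gamma> (Var x) T"
proof (induction \<Gamma> rule: con_induct)
  case (CExt \<Gamma> y S)
  show ?case
  proof (cases "(x, T) = (y, S)")
    case True
    then show ?thesis
      using CExt.prems sound_var_0 sound_ty_weaken by auto
  next
    case False
    then have T: "(x, T) \<in> con_entries \<Gamma>"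
      using CExt.prems by auto
    then have "scoped_ty (con_vars \<Gamma>) T" "scoped_tm (con_vars \<Gamma>) (Var x)"
      using CExt.prems entry_scoped by auto
    then show ?thesis
      using CExt T sound_ty_weaken sound_tm_weaken by auto
  qed
qed auto

lemma coherent_base: "coherent (CExt CEmp x Star)"
proof -
  have "collapse (tm_var M) (CExt CEmp x Star)"
    using loop_typed[of 0] term_eq_refl by (simp add: collapse_def)
  moreover have "has_type M [A] (loop_tm k) P" if "type_eq M [A] P (loop_ty k)" for P k
    using that loop_typed has_type_conv type_eq_sym by blast
  ultimately show ?thesis
    unfolding coherent_def
    by (intro exI[of _ "tm_var M"]) (simp add: ty_sub_id tm_sub_id term_eq_refl loop_typed)
qed

lemma sound_Eq:
  assumes T: "sound_ty \<Gamma> T" and u: "sound_tm \<Gamma> u T" and v: "sound_tm \<Gamma> v T"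
  shows "sound_ty \<Gamma> (Eq u T v)"
proof -
  let ?e = "\<lambda>\<sigma> x. \<sigma> (var_index \<Gamma> x)" and ?k = "ty_dim T"
  have "type_eq M [A] (val_ty (?e \<sigma>) (Eq u T v)) (loop_ty (Suc ?k))" if \<sigma>: "collapse \<sigma> \<Gamma>" for \<sigma>
  proof -
    have T': "type_eq M [A] (val_ty (?e \<sigma>) T) (loop_ty ?k)"
      using T \<sigma> by (simp add: sound_ty_def)
    moreover have "term_eq M [A] (val_tm (?e \<sigma>) w) (loop_tm ?k) (val_ty (?e \<sigma>) T)"
      if "sound_tm \<Gamma> w T" for w
      using that \<sigma> type_eq_sym[OF T'] unfolding sound_tm_def by (blast intro: term_eq_conv)
    ultimately show ?thesis
      using u v by (simp add: Id_cong)
  qed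
  then show ?thesis
    using u v by (simp add: sound_ty_def sound_tm_def Id_form)
qed

text \<open>The inductive step of path induction. The instance of \<open>P\<close> at \<open>(u, refl u)\<close> collapses under \<open>\<rho>\<close> exactly
  as \<open>P\<close> does under the extension of \<open>\<rho>\<close> by these two terms, so the hypothesis on \<open>\<Delta>\<close> applies to it with
  the same \<open>k\<close>.\<close>

lemma coherent_ext:
  assumes wf: "wf_con \<Delta>" "scoped_tm (con_vars \<Delta>) u" "scoped_ty (con_vars \<Delta>) T"
    and \<Delta>: "sound_con \<Delta>" "coherent \<Delta>" and T: "sound_ty \<Delta> T" and u: "sound_tm \<Delta> u T"
    and fresh: "y \<notin> con_vars \<Delta>" "z \<notin> con_vars \<Delta>" "y \<noteq> z"
  defines "\<Delta>' \<equiv> CExt (CExt \<Delta> y T) z (Eq u T (Var y))"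
  shows "coherent \<Delta>'"
proof -
  let ?\<Gamma> = "CExt \<Delta> y T"
  let ?B = "open_ty \<Delta> T" and ?a = "open_tm \<Delta> u"
  have wf': "wf_con ?\<Gamma>"
    using wf fresh by simp
  have a: "has_type M (val_con \<Delta>) ?a ?B"
    using u by (simp add: sound_tm_def)
  have "open_ty ?\<Gamma> (Eq u T (Var y)) =
      Id_ty M (ty_sub M (shift M 1) ?B) (tm_sub M (shift M 1) ?a) (tm_var M 0)"
    using open_weaken[OF wf'] wf by simp
  then have con: "val_con \<Delta>' = J_ctx M (val_con \<Delta>) ?B ?a"
    by (simp add: \<Delta>'_def J_ctx_def)
  from \<Delta>(2) obtain \<rho> where \<rho>: "collapse \<rho> \<Delta>"
    and coh: "\<And>P k. is_type M (val_con \<Delta>) P \<Longrightarrow> type_eq M [A] (ty_sub M \<rho> P) (loop_ty k) \<Longrightarrow>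
        has_type M (val_con \<Delta>) (coherence \<Delta> k P) P \<and>
        term_eq M [A] (tm_sub M \<rho> (coherence \<Delta> k P)) (loop_tm k) (loop_ty k)"
    unfolding coherent_def by blast
  have \<rho>s: "is_subst M [A] \<rho> (val_con \<Delta>)"
    using collapse_unique[OF wf(1) \<Delta>(1) \<rho> \<rho>] by (simp add: subst_eq_def)
  let ?\<rho> = "case_nat (tm_sub M \<rho> (refl_tm M ?B ?a)) (case_nat (tm_sub M \<rho> ?a) \<rho>)"
  have T_eq: "type_eq M [A] (ty_sub M \<rho> ?B) (loop_ty (ty_dim T))"
    and u_eq: "term_eq M [A] (tm_sub M \<rho> ?a) (loop_tm (ty_dim T)) (loop_ty (ty_dim T))"
    using \<rho> T u wf by (auto simp: sound_ty_def sound_tm_def open_sub open_sub_tm)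
  have "term_eq M [A] (refl_tm M (ty_sub M \<rho> ?B) (tm_sub M \<rho> ?a)) (loop_tm (Suc (ty_dim T)))
      (Id_ty M (ty_sub M \<rho> ?B) (tm_sub M \<rho> ?a) (tm_sub M \<rho> ?a))"
    using T_eq u_eq by (auto intro: refl_cong term_eq_conv type_eq_sym)
  moreover have "type_eq M [A] (Id_ty M (ty_sub M \<rho> ?B) (tm_sub M \<rho> ?a) (tm_sub M \<rho> ?a))
      (loop_ty (Suc (ty_dim T)))"
    using T_eq u_eq by (auto intro: Id_cong term_eq_conv type_eq_sym)
  ultimately have refl_eq: "term_eq M [A] (tm_sub M \<rho> (refl_tm M ?B ?a))
      (loop_tm (Suc (ty_dim T))) (loop_ty (Suc (ty_dim T)))"
    by (simp add: refl_sub term_eq_conv del: loop_tm.simps loop_ty.simps)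
  \<comment> \<open>the path \<open>z\<close> has dimension one more than its endpoint \<open>y\<close>, as does the reflexivity of \<open>u\<close>\<close>
  have col: "collapse ?\<rho> \<Delta>'"
    using fresh \<rho> u_eq refl_eq by (simp add: \<Delta>'_def collapse_CExt)
  have "has_type M (val_con \<Delta>') (coherence \<Delta>' k P) P \<and>
        term_eq M [A] (tm_sub M ?\<rho> (coherence \<Delta>' k P)) (loop_tm k) (loop_ty k)"
    if P: "is_type M (val_con \<Delta>') P" and Pk: "type_eq M [A] (ty_sub M ?\<rho> P) (loop_ty k)" for P k
  proof -
    let ?P = "ty_sub M (inst2 M ?a (refl_tm M ?B ?a)) P"
    have "is_subst M (val_con \<Delta>) (inst2 M ?a (refl_tm M ?B ?a)) (val_con \<Delta>')"
      unfolding con inst2_def using a is_subst_id[OF sound_con_is_ctx[OF \<Delta>(1)]]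
      by (intro is_subst_J_ctx) (auto simp: ty_sub_id tm_sub_id intro: refl_intro)
    then have "is_type M (val_con \<Delta>) ?P"
      using P is_type_sub by blast
    moreover have "type_eq M [A] (ty_sub M \<rho> ?P) (loop_ty k)"
      using Pk by (simp add: ty_sub_inst2)
    ultimately have d: "has_type M (val_con \<Delta>) (coherence \<Delta> k ?P) ?P"
      and dk: "term_eq M [A] (tm_sub M \<rho> (coherence \<Delta> k ?P)) (loop_tm k) (loop_ty k)"
      using coh by blast+
    have eq: "coherence \<Delta>' k P = generic_J ?B ?a P (coherence \<Delta> k ?P)"
      by (simp add: \<Delta>'_def Let_def)
    have "has_type M (val_con \<Delta>') (coherence \<Delta>' k P) P"
      using generic_J_type[OF a] P d unfolding eq con by blast
    moreover have "term_eq M [A] (tm_sub M ?\<rho> (coherence \<Delta>' k P)) (tm_sub M \<rho> (coherence \<Delta> k ?P))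
        (loop_ty k)"
      using generic_J_comp[OF a _ d \<rho>s] P Pk unfolding eq con by (blast intro: term_eq_conv)
    ultimately show ?thesis
      using dk term_eq_trans by blast
  qed
  then show ?thesis
    using col unfolding coherent_def by blast
qed

lemma coherent_coh:
  assumes "scoped_ty (con_vars \<Delta>) T" and T: "sound_ty \<Delta> T" and "coherent \<Delta>"
  defines "c \<equiv> coherence \<Delta> (ty_dim T) (open_ty \<Delta> T)"
  obtains \<rho> where "collapse \<rho> \<Delta>" "has_type M (val_con \<Delta>) c (open_ty \<Delta> T)"
    "term_eq M [A] (tm_sub M \<rho> c) (loop_tm (ty_dim T)) (loop_ty (ty_dim T))"
proof -
  obtain \<rho> where \<rho>: "collapse \<rho> \<Delta>"
    and coh: "\<And>P k. is_type M (val_con \<Delta>) P \<Longrightarrow> type_eq M [A] (ty_sub M \<rho> P) (loop_ty k) \<Longrightarrow>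
        has_type M (val_con \<Delta>) (coherence \<Delta> k P) P \<and>
        term_eq M [A] (tm_sub M \<rho> (coherence \<Delta> k P)) (loop_tm k) (loop_ty k)"
    using assms(3) unfolding coherent_def by blast
  have "is_type M (val_con \<Delta>) (open_ty \<Delta> T)"
    "type_eq M [A] (ty_sub M \<rho> (open_ty \<Delta> T)) (loop_ty (ty_dim T))"
    using T \<rho> by (auto simp: sound_ty_def open_sub[OF assms(1)])
  from coh[OF this] \<rho> show thesis
    using that[of \<rho>] unfolding c_def by blast
qed

text \<open>If \<open>\<sigma>\<close> collapses \<open>\<Gamma>\<close>, then \<open>\<sigma>\<close> composed with \<open>\<delta>\<close> collapses \<open>\<Delta>\<close>. It may therefore be replaced by the
  collapsing substitution under which the coherence is known to compute to an iterated reflexivity.\<close>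

lemma sound_coh:
  assumes wf: "wf_con \<Delta>" "scoped_ty (con_vars \<Delta>) T" and mor: "mor_ok \<Gamma> \<delta> \<Delta>"
    and \<Delta>: "sound_con \<Delta>" "coherent \<Delta>" and T: "sound_ty \<Delta> T" and \<delta>: "sound_mor \<Gamma> \<delta> \<Delta>"
  shows "sound_ty \<Gamma> (subst_ty \<Delta> \<delta> T)" and "sound_tm \<Gamma> (Coh \<Delta> T \<delta>) (subst_ty \<Delta> \<delta> T)"
proof -
  note eq = val_ty_subst[OF mor wf(2)] and sub = open_sub[OF wf(2)]
  let ?c = "coherence \<Delta> (ty_dim T) (open_ty \<Delta> T)"
  obtain \<rho> where \<rho>: "collapse \<rho> \<Delta>" and c: "has_type M (val_con \<Delta>) ?c (open_ty \<Delta> T)"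
    and \<rho>c: "term_eq M [A] (tm_sub M \<rho> ?c) (loop_tm (ty_dim T)) (loop_ty (ty_dim T))"
    using coherent_coh[OF wf(2) T \<Delta>(2)] by blast
  show "sound_ty \<Gamma> (subst_ty \<Delta> \<delta> T)"
    using T \<delta> unfolding sound_ty_def sound_mor_def eq ty_dim_subst
    by (metis sub is_type_sub)
  have "term_eq M [A] (tm_sub M \<tau> ?c) (loop_tm (ty_dim T)) (loop_ty (ty_dim T))"
    if \<tau>: "collapse \<tau> \<Delta>" for \<tau>
  proof -
    have "term_eq M [A] (tm_sub M \<tau> ?c) (tm_sub M \<rho> ?c) (ty_sub M \<tau> (open_ty \<Delta> T))"
      using term_eq_sub[OF collapse_unique[OF wf(1) \<Delta>(1) \<tau> \<rho>]] c term_eq_refl by blast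
    moreover have "type_eq M [A] (ty_sub M \<tau> (open_ty \<Delta> T)) (loop_ty (ty_dim T))"
      using T \<tau> unfolding sound_ty_def sub by blast
    ultimately show ?thesis
      using \<rho>c term_eq_conv term_eq_trans by blast
  qed
  moreover have "has_type M (val_con \<Gamma>) (open_tm \<Gamma> (Coh \<Delta> T \<delta>)) (open_ty \<Gamma> (subst_ty \<Delta> \<delta> T))"
    using has_type_sub[OF _ c] \<delta> unfolding sound_mor_def eq by (simp add: sub)
  ultimately show "sound_tm \<Gamma> (Coh \<Delta> T \<delta>) (subst_ty \<Delta> \<delta> T)"
    using \<delta> unfolding sound_tm_def sound_mor_def by (simp add: ty_dim_subst)
qed

lemma mor_ok_length: "mor_ok \<Gamma> \<delta> \<Delta> \<Longrightarrow> mor_length \<delta> = length (val_con \<Delta>)"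
  by (induction \<Delta> arbitrary: \<delta> rule: con_induct) (auto elim: mor_ok.cases)

lemma list_subst_tail:
  assumes "length ts = length (val_con \<Gamma>)" and "\<Gamma> \<noteq> CEmp"
  shows "(\<lambda>i. list_subst (t # ts) (Suc i)) = list_subst ts"
  using assms by (cases \<Gamma>) (auto simp: list_subst_def fun_eq_iff)

lemma list_subst_tail_var:
  assumes "length ts = length (val_con \<Gamma>)" and "x \<in> con_vars \<Gamma>"
  shows "list_subst (t # ts) (Suc (var_index \<Gamma> x)) = list_subst ts (var_index \<Gamma> x)"
  using list_subst_tail[of ts \<Gamma> t] assms by (cases "\<Gamma> = CEmp") (auto dest: fun_cong)

text \<open>The tail of \<open>list_subst (t # ts)\<close> is \<open>list_subst ts\<close> except when \<open>ts\<close> is empty, where the default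
  values differ. The context is then empty too, and its substitutions are unconstrained.\<close>

lemma is_subst_list_Cons:
  assumes len: "length ts = length (val_con \<Gamma>)" and T: "scoped_ty (con_vars \<Gamma>) T" "sound_ty \<Gamma> T"
    and ts: "is_subst M \<Theta> (list_subst ts) (val_con \<Gamma>)"
    and t: "has_type M \<Theta> t (val_ty (\<lambda>x. list_subst ts (var_index \<Gamma> x)) T)"
  shows "is_subst M \<Theta> (list_subst (t # ts)) (val_con (CExt \<Gamma> x T))"
proof -
  have "is_subst M \<Theta> (\<lambda>i. list_subst (t # ts) (Suc i)) (val_con \<Gamma>)"
    using ts list_subst_tail[OF len] by (cases "\<Gamma> = CEmp") (auto simp: is_subst_def)
  moreover have "ty_sub M (\<lambda>i. list_subst (t # ts) (Suc i)) (open_ty \<Gamma> T) =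
      val_ty (\<lambda>x. list_subst ts (var_index \<Gamma> x)) T"
    unfolding open_sub[OF T(1)] using T(1) list_subst_tail_var[OF len] by (rule val_cong(2))
  ultimately show ?thesis
    using T(2) t by (simp add: is_subst_Cons sound_ty_def)
qed

lemma collapse_list_Cons:
  assumes "length ts = length (val_con \<Gamma>)" and "x \<notin> con_vars \<Gamma>" and "collapse (list_subst ts) \<Gamma>"
    and "term_eq M [A] t (loop_tm (ty_dim T)) (loop_ty (ty_dim T))"
  shows "collapse (list_subst (t # ts)) (CExt \<Gamma> x T)"
proof -
  have "collapse (\<lambda>i. list_subst (t # ts) (Suc i)) \<Gamma>"
    using assms list_subst_tail[OF assms(1)] by (cases "\<Gamma> = CEmp") (auto simp: collapse_def)
  then show ?thesis
    using assms by (simp add: collapse_CExt)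
qed

lemma sound_mor_ext:
  assumes wf: "scoped_ty (con_vars \<Delta>) T" "x \<notin> con_vars \<Delta>" and mor: "mor_ok \<Gamma> \<delta> \<Delta>"
    and T: "sound_ty \<Delta> T" and \<delta>: "sound_mor \<Gamma> \<delta> \<Delta>" and u: "sound_tm \<Gamma> u (subst_ty \<Delta> \<delta> T)"
  shows "sound_mor \<Gamma> (MExt \<delta> u) (CExt \<Delta> x T)"
  using wf T \<delta> u mor_ok_length[OF mor]
  unfolding sound_mor_def sound_tm_def val_ty_subst[OF mor wf(1)] ty_dim_subst val_mor.simps
  by (intro conjI is_subst_list_Cons allI impI collapse_list_Cons) simp_all

lemma soundness:
  "con_ok \<Gamma> \<Longrightarrow> sound_con \<Gamma>"
  "mor_ok \<Gamma> \<delta> \<Delta> \<Longrightarrow> sound_con \<Gamma> \<and> sound_mor \<Gamma> \<delta> \<Delta>"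
  "ty_ok \<Gamma> T \<Longrightarrow> sound_con \<Gamma> \<and> sound_ty \<Gamma> T"
  "tm_ok \<Gamma> u T \<Longrightarrow> sound_con \<Gamma> \<and> sound_ty \<Gamma> T \<and> sound_tm \<Gamma> u T"
  "contractible \<Delta> \<Longrightarrow> coherent \<Delta>"
proof (induction rule: con_ok_mor_ok_ty_ok_tm_ok_contractible.inducts)
  case (mor_emp \<Gamma>)
  then show ?case
    by (simp add: sound_mor_def is_subst_def collapse_def sound_con_is_ctx)
next
  case (mor_ext \<Delta> T \<Gamma> \<delta> u x)
  then show ?case
    using sound_mor_ext typed_scoped(3) by blast
next
  case (ty_star \<Gamma>)
  have "is_subst M (val_con \<Gamma>) (tm_var M) []"
    using ty_star sound_con_is_ctx by (simp add: is_subst_def)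
  moreover have "is_subst M [A] (tm_var M) []"
    using closed by (simp add: is_subst_def)
  ultimately show ?case
    using ty_star is_type_sub[OF _ closed] type_eq_refl by (fastforce simp: sound_ty_def A_sub)
next
  case (ty_eq \<Gamma> u T v)
  then show ?case
    using sound_Eq by blast
next
  case (tm_variable \<Gamma> x T)
  then show ?case
    using sound_var typed_scoped(1) by blast
next
  case (tm_coh \<Delta> T \<Gamma> \<delta>)
  then show ?case
    using sound_coh typed_scoped(3) by blast
next
  case (contr_base x)
  show ?case
    by (rule coherent_base)
next
  case (contr_ext \<Delta> u T y z)
  then show ?case
    using coherent_ext typed_scoped(4) by blast
qed auto



section \<open>Cells of the iterated homs\<close>

text \<open>A \<open>0\<close>-cell of an iterated hom of \<open>A\<^sup>G\<close> is a term \<open>t\<close> of an iterated identity type, nested in one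
  \<open>Arr\<close> for each pair of endpoints: \<open>core\<close> recovers \<open>t\<close>, and \<open>wrap\<close> restores the endpoints, which can be
  read off the type \<open>T\<close>.\<close>

primrec core :: "'t cell \<Rightarrow> 't" where
  "core (Pt t) = t"
| "core (Arr t u \<sigma>) = core \<sigma>"

primrec wrap :: "(var \<Rightarrow> 't) \<Rightarrow> ty \<Rightarrow> 't cell \<Rightarrow> 't cell" where
  "wrap e Star x = x"
| "wrap e (Eq u T v) x = wrap e T (Arr (val_tm e u) (val_tm e v) x)"

lemma wrap_Eq: "wrap e (Eq u T v) = (\<lambda>x. wrap e T (Arr (val_tm e u) (val_tm e v) x))"
  by (simp add: fun_eq_iff)

lemma core_wrap [simp]: "core (wrap e T x) = core x"
  by (induction T arbitrary: x rule: ty_induct) auto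

lemma wrap_cong:
  "scoped_ty V T \<Longrightarrow> (\<And>x. x \<in> V \<Longrightarrow> e x = e' x) \<Longrightarrow> wrap e T z = wrap e' T z"
  by (induction T arbitrary: z rule: ty_induct) (auto simp: val_cong(3)[of V _ e e'])

lemma wrap_subst:
  "wrap e (subst_ty \<Gamma> \<gamma> T) z = wrap (\<lambda>x. val_tm e (sub_var \<Gamma> \<gamma> x)) T z"
  by (induction T arbitrary: z rule: ty_induct) (auto simp: val_subst)

lemma wrap_ty_subst:
  assumes "mor_ok \<Gamma> \<delta> \<Delta>" "scoped_ty (con_vars \<Delta>) T"
  shows "wrap e (subst_ty \<Delta> \<delta> T) z = wrap (\<lambda>x. list_subst (val_mor e \<delta>) (var_index \<Delta> x)) T z"
  unfolding wrap_subst using assms by (intro wrap_cong) (auto simp: list_subst_val_mor)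

lemma cell_src_tgt_typed:
  "x \<in> type_cells M (Suc n) B \<Longrightarrow> cell_src n x \<in> type_cells M n B \<and> cell_tgt n x \<in> type_cells M n B"
proof (induction n arbitrary: x B)
  case (Suc n)
  then obtain t u \<sigma> where "x = Arr t u \<sigma>" "has_type M [] t B" "has_type M [] u B"
    "\<sigma> \<in> type_cells M (Suc n) (Id_ty M B t u)"
    unfolding type_cells.simps(2)[of M "Suc n" B] by blast
  then show ?case
    using Suc.IH by (simp del: type_cells.simps(2) add: type_cells.simps(2)[of M n B])
qed auto

lemma cell_globular:
  "x \<in> type_cells M (Suc (Suc n)) B \<Longrightarrow>
     cell_src n (cell_src (Suc n) x) = cell_src n (cell_tgt (Suc n) x) \<and>
     cell_tgt n (cell_src (Suc n) x) = cell_tgt n (cell_tgt (Suc n) x)"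
proof (induction n arbitrary: x B)
  case (Suc n)
  then obtain t u \<sigma> where "x = Arr t u \<sigma>" "\<sigma> \<in> type_cells M (Suc (Suc n)) (Id_ty M B t u)"
    unfolding type_cells.simps(2)[of M "Suc (Suc n)" B] by blast
  then show ?case
    using Suc.IH by (simp del: type_cells.simps(2))
qed auto

lemma globular_type_globular: "globular_set (type_globular M B)"
  unfolding globular_set_def type_globular_def
  using cell_src_tgt_typed cell_globular by (simp del: type_cells.simps cell_src.simps cell_tgt.simps)

text \<open>\<open>H\<close> is the copy of \<open>B\<^sup>G\<close> along the renaming \<open>W\<close> of cells, which will be a \<open>wrap\<close>. Such a renaming
  distinguishes \<open>0\<close>-cells because it preserves \<open>core\<close>.\<close>

definition represents :: "'t cell globular \<Rightarrow> ('t cell \<Rightarrow> 't cell) \<Rightarrow> 'T \<Rightarrow> bool" where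
  "represents H W B \<longleftrightarrow> (\<forall>n. cells H n = W ` type_cells M n B) \<and>
     (\<forall>n. \<forall>x \<in> type_cells M (Suc n) B. src H n (W x) = W (cell_src n x) \<and> tgt H n (W x) = W (cell_tgt n x))"

lemma represents_0:
  assumes "represents H W B" "x \<in> type_cells M n B"
  shows "src0 H n (W x) = W (src0 (type_globular M B) n x)"
    and "tgt0 H n (W x) = W (tgt0 (type_globular M B) n x)"
proof -
  have "x \<in> type_cells M n B \<Longrightarrow> src0 H n (W x) = W (src0 (type_globular M B) n x) \<and>
      tgt0 H n (W x) = W (tgt0 (type_globular M B) n x)"
  proof (induction n arbitrary: x)
    case (Suc n)
    have W: "src H n (W x) = W (cell_src n x)" "tgt H n (W x) = W (cell_tgt n x)"
      using assms(1) Suc.prems unfolding represents_def by blast+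
    have G: "src (type_globular M B) n x = cell_src n x" "tgt (type_globular M B) n x = cell_tgt n x"
      by (simp_all add: type_globular_def)
    show ?case
      using Suc.IH cell_src_tgt_typed[OF Suc.prems] unfolding src0.simps tgt0.simps W G by blast
  qed simp
  then show "src0 H n (W x) = W (src0 (type_globular M B) n x)"
    and "tgt0 H n (W x) = W (tgt0 (type_globular M B) n x)"
    using assms(2) by blast+
qed

text \<open>Iterating \<open>Hom\<close> on the globular side is iterating \<open>Id_ty\<close> on the side of the type theory; the
  renaming absorbs the recorded endpoints.\<close>

lemma represents_Hom:
  assumes H: "represents H W B" and W: "\<And>x. core (W x) = core x"
    and tu: "has_type M [] t B" "has_type M [] u B"
  shows "represents (Hom H (W (Pt t)) (W (Pt u))) (\<lambda>x. W (Arr t u x)) (Id_ty M B t u)"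
proof -
  have inj: "W (Pt a) = W (Pt b) \<longleftrightarrow> a = b" for a b
    by (metis W core.simps(1))
  have "cells (Hom H (W (Pt t)) (W (Pt u))) n = (\<lambda>x. W (Arr t u x)) ` type_cells M n (Id_ty M B t u)"
    (is "?L = ?R") for n
  proof (intro set_eqI iffI)
    fix z assume "z \<in> ?L"
    then have z: "z \<in> cells H (Suc n)" "src0 H (Suc n) z = W (Pt t)" "tgt0 H (Suc n) z = W (Pt u)"
      by (simp_all add: Hom_def del: src0.simps tgt0.simps)
    then obtain y where y: "y \<in> type_cells M (Suc n) B" "z = W y"
      using H unfolding represents_def by blast
    from y(1) obtain a b s where s: "y = Arr a b s" "s \<in> type_cells M n (Id_ty M B a b)"
      unfolding type_cells.simps by blast
    have "a = t" "b = u"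
      using z(2,3) represents_0[OF H y(1)]
      unfolding y(2) s(1) src0_type_globular tgt0_type_globular by (simp_all only: inj)
    then show "z \<in> ?R"
      using y s by blast
  next
    fix z assume "z \<in> ?R"
    then obtain s where s: "s \<in> type_cells M n (Id_ty M B t u)" "z = W (Arr t u s)"
      by blast
    then have y: "Arr t u s \<in> type_cells M (Suc n) B"
      unfolding type_cells.simps using tu by blast
    then have "z \<in> cells H (Suc n)"
      using H s unfolding represents_def by blast
    then show "z \<in> ?L"
      using represents_0[OF H y] s
      by (simp add: Hom_def src0_type_globular tgt0_type_globular del: src0.simps tgt0.simps)
  qed
  moreover have "src H (Suc n) (W (Arr t u x)) = W (Arr t u (cell_src n x)) \<and>
      tgt H (Suc n) (W (Arr t u x)) = W (Arr t u (cell_tgt n x))"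
    if "x \<in> type_cells M (Suc n) (Id_ty M B t u)" for n x
  proof -
    have "Arr t u x \<in> type_cells M (Suc (Suc n)) B"
      using that tu by simp
    then show ?thesis
      using H unfolding represents_def by (simp del: type_cells.simps)
  qed
  ultimately show ?thesis
    unfolding represents_def by (simp add: Hom_def del: type_cells.simps)
qed

lemma represents_Ob:
  "represents H W B \<Longrightarrow> x \<in> Ob H \<longleftrightarrow> (\<exists>t. has_type M [] t B \<and> x = W (Pt t))"
  by (auto simp: represents_def Ob_def)

section \<open>The coherence operations\<close>

definition core_subst :: "'t cell list \<Rightarrow> nat \<Rightarrow> 't" where
  "core_subst \<gamma> = list_subst (map core \<gamma>)"

abbreviation core_env :: "con \<Rightarrow> 't cell list \<Rightarrow> var \<Rightarrow> 't" where
  "core_env \<Gamma> \<gamma> \<equiv> \<lambda>x. core_subst \<gamma> (var_index \<Gamma> x)"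

text \<open>The endpoints of the result are evaluated in the type theory, and not by the globular
  interpretation, which would need \<open>coh_op\<close> itself. That the two agree is \<open>interpretation_ok\<close>.\<close>

definition coh_op :: "'t cell coherences" where
  "coh_op \<Delta> T \<eta> = wrap (core_env \<Delta> \<eta>) T
     (Pt (tm_sub M (core_subst \<eta>) (coherence \<Delta> (ty_dim T) (open_ty \<Delta> T))))"

abbreviation cells_con :: "con \<Rightarrow> 't cell list set" where
  "cells_con \<equiv> interp_con (type_globular M A) coh_op"
abbreviation cells_ty :: "con \<Rightarrow> ty \<Rightarrow> 't cell list \<Rightarrow> 't cell globular" where
  "cells_ty \<equiv> interp_ty (type_globular M A) coh_op"
abbreviation cells_tm :: "con \<Rightarrow> tm \<Rightarrow> 't cell list \<Rightarrow> 't cell" where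
  "cells_tm \<equiv> interp_tm (type_globular M A) coh_op"
abbreviation cells_mor :: "con \<Rightarrow> mor \<Rightarrow> 't cell list \<Rightarrow> 't cell list" where
  "cells_mor \<equiv> interp_mor (type_globular M A) coh_op"

text \<open>The evaluations have to agree as raw terms, since a hom of \<open>A\<^sup>G\<close> compares endpoints as raw terms.
  They do, because substitution in the type theory is strictly functorial: definitional equality
  enters only through the typing of the coherences.\<close>

definition interp_ok_ty :: "con \<Rightarrow> ty \<Rightarrow> bool" where
  "interp_ok_ty \<Gamma> T \<longleftrightarrow> (\<forall>\<gamma> \<in> cells_con \<Gamma>.
     represents (cells_ty \<Gamma> T \<gamma>) (wrap (core_env \<Gamma> \<gamma>) T) (val_ty (core_env \<Gamma> \<gamma>) T))"

definition interp_ok_tm :: "con \<Rightarrow> tm \<Rightarrow> ty \<Rightarrow> bool" where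
  "interp_ok_tm \<Gamma> u T \<longleftrightarrow> (\<forall>\<gamma> \<in> cells_con \<Gamma>.
     cells_tm \<Gamma> u \<gamma> = wrap (core_env \<Gamma> \<gamma>) T (Pt (val_tm (core_env \<Gamma> \<gamma>) u)))"

definition interp_ok_mor :: "con \<Rightarrow> mor \<Rightarrow> con \<Rightarrow> bool" where
  "interp_ok_mor \<Gamma> \<delta> \<Delta> \<longleftrightarrow> (\<forall>\<gamma> \<in> cells_con \<Gamma>.
     cells_mor \<Gamma> \<delta> \<gamma> \<in> cells_con \<Delta> \<and> map core (cells_mor \<Gamma> \<delta> \<gamma>) = val_mor (core_env \<Gamma> \<gamma>) \<delta>)"

primrec interp_ok_con :: "con \<Rightarrow> bool" where
  "interp_ok_con CEmp = True"
| "interp_ok_con (CExt \<Gamma> x T) = (interp_ok_con \<Gamma> \<and> interp_ok_ty \<Gamma> T)"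

lemma interp_ok_Ob:
  assumes "interp_ok_ty \<Gamma> T" "\<gamma> \<in> cells_con \<Gamma>"
  shows "a \<in> Ob (cells_ty \<Gamma> T \<gamma>) \<longleftrightarrow>
    (\<exists>t. has_type M [] t (val_ty (core_env \<Gamma> \<gamma>) T) \<and> a = wrap (core_env \<Gamma> \<gamma>) T (Pt t))"
  using assms unfolding interp_ok_ty_def by (blast intro!: represents_Ob)

lemma cells_con_length: "\<gamma> \<in> cells_con \<Gamma> \<Longrightarrow> length \<gamma> = length (val_con \<Gamma>)"
  by (induction \<Gamma> arbitrary: \<gamma> rule: con_induct) auto

lemma core_is_subst:
  "wf_con \<Gamma> \<Longrightarrow> sound_con \<Gamma> \<Longrightarrow> interp_ok_con \<Gamma> \<Longrightarrow> \<gamma> \<in> cells_con \<Gamma> \<Longrightarrow>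
     is_subst M [] (core_subst \<gamma>) (val_con \<Gamma>)"
proof (induction \<Gamma> arbitrary: \<gamma> rule: con_induct)
  case (CExt \<Gamma> x T)
  then obtain a \<gamma>' where \<gamma>: "\<gamma> = a # \<gamma>'" "\<gamma>' \<in> cells_con \<Gamma>" "a \<in> Ob (cells_ty \<Gamma> T \<gamma>')"
    by auto
  then have "has_type M [] (core a) (val_ty (core_env \<Gamma> \<gamma>') T)"
    using CExt.prems by (auto simp: interp_ok_Ob)
  then show ?case
    using CExt \<gamma> cells_con_length[OF \<gamma>(2)] is_subst_list_Cons[of "map core \<gamma>'" \<Gamma> T "[]" "core a" x]
    by (simp add: core_subst_def)
qed (simp add: is_subst_def)

lemma core_has_type:
  assumes "tm_ok \<Gamma> u T" "interp_ok_con \<Gamma>" "\<gamma> \<in> cells_con \<Gamma>"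
  shows "has_type M [] (val_tm (core_env \<Gamma> \<gamma>) u) (val_ty (core_env \<Gamma> \<gamma>) T)"
proof -
  have s: "sound_con \<Gamma>" "sound_tm \<Gamma> u T" and wf: "wf_con \<Gamma>"
    and sc: "scoped_tm (con_vars \<Gamma>) u" "scoped_ty (con_vars \<Gamma>) T"
    using assms(1) soundness(4) typed_scoped(4) by blast+
  show ?thesis
    using has_type_sub[OF core_is_subst[OF wf s(1) assms(2,3)]] s(2)
    unfolding sound_tm_def by (metis open_sub[OF sc(2)] open_sub_tm[OF sc(1)])
qed

lemma core_env_CExt:
  assumes "\<gamma> \<in> cells_con \<Gamma>" "x \<in> con_vars \<Gamma>" "y \<notin> con_vars \<Gamma>"
  shows "core_env (CExt \<Gamma> y S) (a # \<gamma>) x = core_env \<Gamma> \<gamma> x"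
  using assms list_subst_tail_var[of "map core \<gamma>" \<Gamma> x] cells_con_length[OF assms(1)]
  by (auto simp: core_subst_def)

lemma interp_weaken:
  "True"
  "scoped_ty V T \<Longrightarrow> y \<notin> V \<Longrightarrow> interp_ty G c (CExt \<Gamma> y S) T (a # \<gamma>) = interp_ty G c \<Gamma> T \<gamma>"
  "scoped_tm V u \<Longrightarrow> y \<notin> V \<Longrightarrow> interp_tm G c (CExt \<Gamma> y S) u (a # \<gamma>) = interp_tm G c \<Gamma> u \<gamma>"
  "scoped_mor V \<delta> \<Longrightarrow> y \<notin> V \<Longrightarrow> interp_mor G c (CExt \<Gamma> y S) \<delta> (a # \<gamma>) = interp_mor G c \<Gamma> \<delta> \<gamma>"
  for \<Delta> :: con
  by (induction \<Delta> and T and u and \<delta>) auto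

lemma interp_sub_var:
  "mor_ok \<Gamma> \<delta> \<Delta> \<Longrightarrow> x \<in> con_vars \<Delta> \<Longrightarrow>
     interp_tm G c \<Gamma> (sub_var \<Delta> \<delta> x) \<gamma> = component \<Delta> (interp_mor G c \<Gamma> \<delta> \<gamma>) x"
  by (induction \<Delta> \<delta> x rule: sub_var.induct) (auto elim: mor_ok.cases)

lemma interp_subst:
  fixes \<Theta> :: con
  assumes "mor_ok \<Gamma> \<delta> \<Delta>"
  shows "True"
    "scoped_ty (con_vars \<Delta>) T \<Longrightarrow>
       interp_ty G c \<Gamma> (subst_ty \<Delta> \<delta> T) \<gamma> = interp_ty G c \<Delta> T (interp_mor G c \<Gamma> \<delta> \<gamma>)"
    "scoped_tm (con_vars \<Delta>) u \<Longrightarrow>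
       interp_tm G c \<Gamma> (subst_tm \<Delta> \<delta> u) \<gamma> = interp_tm G c \<Delta> u (interp_mor G c \<Gamma> \<delta> \<gamma>)"
    "scoped_mor (con_vars \<Delta>) \<theta> \<Longrightarrow>
       interp_mor G c \<Gamma> (subst_mor \<Delta> \<delta> \<theta>) \<gamma> = interp_mor G c \<Delta> \<theta> (interp_mor G c \<Gamma> \<delta> \<gamma>)"
  by (induction \<Theta> and T and u and \<theta>) (auto simp: interp_sub_var[OF assms])

lemma interp_ok_var:
  "wf_con \<Gamma> \<Longrightarrow> interp_ok_con \<Gamma> \<Longrightarrow> (x, T) \<in> con_entries \<Gamma> \<Longrightarrow> interp_ok_ty \<Gamma> T \<and> interp_ok_tm \<Gamma> (Var x) T"
proof (induction \<Gamma> rule: con_induct)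
  case (CExt \<Gamma> y S)
  have y: "y \<notin> con_vars \<Gamma>" and wf: "wf_con \<Gamma>"
    using CExt.prems by auto
  have \<Gamma>: "interp_ok_con \<Gamma>"
    using CExt.prems(2) by simp
  have T: "scoped_ty (con_vars \<Gamma>) T \<and> interp_ok_ty \<Gamma> T"
  proof (cases "(x, T) \<in> con_entries \<Gamma>")
    case True
    then show ?thesis
      using CExt.IH[OF wf \<Gamma>] entry_scoped(2)[OF wf] by blast
  next
    case False
    then show ?thesis
      using CExt.prems by simp
  qed
  note T = T[THEN conjunct1] T[THEN conjunct2]
  have "represents (cells_ty (CExt \<Gamma> y S) T (a # \<gamma>)) (wrap (core_env (CExt \<Gamma> y S) (a # \<gamma>)) T)
        (val_ty (core_env (CExt \<Gamma> y S) (a # \<gamma>)) T) \<and>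
      component (CExt \<Gamma> y S) (a # \<gamma>) x =
        wrap (core_env (CExt \<Gamma> y S) (a # \<gamma>)) T (Pt (core_env (CExt \<Gamma> y S) (a # \<gamma>) x))"
    if \<gamma>: "\<gamma> \<in> cells_con \<Gamma>" and a: "a \<in> Ob (cells_ty \<Gamma> S \<gamma>)" for a \<gamma>
  proof -
    note env = core_env_CExt[OF \<gamma> _ y, where S = S and a = a]
    have v: "val_ty (core_env (CExt \<Gamma> y S) (a # \<gamma>)) T = val_ty (core_env \<Gamma> \<gamma>) T"
      by (rule val_cong(2)[OF T(1)]) (rule env)
    have w: "wrap (core_env (CExt \<Gamma> y S) (a # \<gamma>)) T = wrap (core_env \<Gamma> \<gamma>) T"
      by (rule ext, rule wrap_cong[OF T(1)]) (rule env)
    have "represents (cells_ty \<Gamma> T \<gamma>) (wrap (core_env \<Gamma> \<gamma>) T) (val_ty (core_env \<Gamma> \<gamma>) T)"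
      using T(2) \<gamma> by (simp add: interp_ok_ty_def)
    moreover have "component (CExt \<Gamma> y S) (a # \<gamma>) x =
        wrap (core_env \<Gamma> \<gamma>) T (Pt (core_env (CExt \<Gamma> y S) (a # \<gamma>) x))"
    proof (cases "x = y")
      case True
      then have "(x, T) \<notin> con_entries \<Gamma>"
        using y entry_scoped(1)[OF wf] by blast
      then have "S = T"
        using CExt.prems by simp
      then show ?thesis
        using True a \<gamma> T(2) by (auto simp: interp_ok_Ob core_subst_def)
    next
      case False
      then have x: "(x, T) \<in> con_entries \<Gamma>"
        using CExt.prems by simp
      then show ?thesis
        using CExt False \<gamma> env[OF entry_scoped(1)[OF wf x]] by (auto simp: interp_ok_tm_def)
    qed
    ultimately show ?thesis
      unfolding v w interp_weaken(2)[OF T(1) y] by blast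
  qed
  then show ?case
    unfolding interp_ok_ty_def interp_ok_tm_def by (auto simp del: component.simps var_index.simps)
qed simp

lemma interpretation_ok:
  "con_ok \<Gamma> \<Longrightarrow> interp_ok_con \<Gamma>"
  "mor_ok \<Gamma> \<delta> \<Delta> \<Longrightarrow> interp_ok_con \<Gamma> \<and> interp_ok_mor \<Gamma> \<delta> \<Delta>"
  "ty_ok \<Gamma> T \<Longrightarrow> interp_ok_con \<Gamma> \<and> interp_ok_ty \<Gamma> T"
  "tm_ok \<Gamma> u T \<Longrightarrow> interp_ok_con \<Gamma> \<and> interp_ok_ty \<Gamma> T \<and> interp_ok_tm \<Gamma> u T"
  "contractible \<Delta> \<Longrightarrow> True"
proof (induction rule: con_ok_mor_ok_ty_ok_tm_ok_contractible.inducts)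
  case (mor_emp \<Gamma>)
  then show ?case
    by (simp add: interp_ok_mor_def)
next
  case (mor_ext \<Delta> T \<Gamma> \<delta> u x)
  then have T: "scoped_ty (con_vars \<Delta>) T"
    using typed_scoped(3) by blast
  have "cells_tm \<Gamma> u \<gamma> \<in> Ob (cells_ty \<Delta> T \<eta>) \<and> core (cells_tm \<Gamma> u \<gamma>) = val_tm (core_env \<Gamma> \<gamma>) u"
    if \<gamma>: "\<gamma> \<in> cells_con \<Gamma>" and \<eta>: "\<eta> = cells_mor \<Gamma> \<delta> \<gamma>" for \<gamma> \<eta>
  proof -
    have \<eta>\<Delta>: "\<eta> \<in> cells_con \<Delta>" and s: "list_subst (val_mor (core_env \<Gamma> \<gamma>) \<delta>) = core_subst \<eta>"
      using mor_ext.IH(2) \<gamma> \<eta> by (simp_all add: interp_ok_mor_def core_subst_def)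
    note eq = val_ty_subst[OF mor_ext.hyps(2) T, of "core_env \<Gamma> \<gamma>", unfolded s]
      wrap_ty_subst[OF mor_ext.hyps(2) T, of "core_env \<Gamma> \<gamma>", unfolded s]
    have "has_type M [] (val_tm (core_env \<Gamma> \<gamma>) u) (val_ty (core_env \<Delta> \<eta>) T)"
      using core_has_type[OF mor_ext.hyps(3) _ \<gamma>] mor_ext.IH by (simp add: eq)
    moreover have "cells_tm \<Gamma> u \<gamma> = wrap (core_env \<Delta> \<eta>) T (Pt (val_tm (core_env \<Gamma> \<gamma>) u))"
      using mor_ext.IH(3) \<gamma> by (simp add: interp_ok_tm_def eq)
    ultimately show ?thesis
      using mor_ext.IH(1) \<eta>\<Delta> by (auto simp: interp_ok_Ob)
  qed
  then show ?case
    using mor_ext.IH by (simp add: interp_ok_mor_def)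
next
  case (ty_star \<Gamma>)
  then show ?case
    by (simp add: interp_ok_ty_def represents_def type_globular_def)
next
  case (ty_eq \<Gamma> u T v)
  have "represents (cells_ty \<Gamma> (Eq u T v) \<gamma>) (wrap (core_env \<Gamma> \<gamma>) (Eq u T v))
      (val_ty (core_env \<Gamma> \<gamma>) (Eq u T v))" if \<gamma>: "\<gamma> \<in> cells_con \<Gamma>" for \<gamma>
  proof -
    have T: "represents (cells_ty \<Gamma> T \<gamma>) (wrap (core_env \<Gamma> \<gamma>) T) (val_ty (core_env \<Gamma> \<gamma>) T)"
      using ty_eq.IH \<gamma> unfolding interp_ok_ty_def by blast
    have uv: "cells_tm \<Gamma> u \<gamma> = wrap (core_env \<Gamma> \<gamma>) T (Pt (val_tm (core_env \<Gamma> \<gamma>) u))"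
      "cells_tm \<Gamma> v \<gamma> = wrap (core_env \<Gamma> \<gamma>) T (Pt (val_tm (core_env \<Gamma> \<gamma>) v))"
      using ty_eq.IH \<gamma> unfolding interp_ok_tm_def by blast+
    show ?thesis
      unfolding interp_ty.simps val_ty.simps wrap_Eq uv
      by (intro represents_Hom[OF T] core_wrap core_has_type ty_eq.hyps \<gamma>
          ty_eq.IH(1)[THEN conjunct1])
  qed
  then show ?case
    using ty_eq.IH by (simp add: interp_ok_ty_def)
next
  case (tm_variable \<Gamma> x T)
  then show ?case
    using interp_ok_var typed_scoped(1) by blast
next
  case (tm_coh \<Delta> T \<Gamma> \<delta>)
  then have T: "scoped_ty (con_vars \<Delta>) T"
    using typed_scoped(3) by blast
  have "represents (cells_ty \<Gamma> (subst_ty \<Delta> \<delta> T) \<gamma>) (wrap (core_env \<Gamma> \<gamma>) (subst_ty \<Delta> \<delta> T))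
        (val_ty (core_env \<Gamma> \<gamma>) (subst_ty \<Delta> \<delta> T)) \<and>
      cells_tm \<Gamma> (Coh \<Delta> T \<delta>) \<gamma> =
        wrap (core_env \<Gamma> \<gamma>) (subst_ty \<Delta> \<delta> T) (Pt (val_tm (core_env \<Gamma> \<gamma>) (Coh \<Delta> T \<delta>)))"
    if \<gamma>: "\<gamma> \<in> cells_con \<Gamma>" for \<gamma>
  proof -
    let ?\<eta> = "cells_mor \<Gamma> \<delta> \<gamma>"
    have \<eta>: "?\<eta> \<in> cells_con \<Delta>" and s: "list_subst (val_mor (core_env \<Gamma> \<gamma>) \<delta>) = core_subst ?\<eta>"
      using tm_coh.IH \<gamma> by (simp_all add: interp_ok_mor_def core_subst_def)
    have v: "val_ty (core_env \<Gamma> \<gamma>) (subst_ty \<Delta> \<delta> T) = val_ty (core_env \<Delta> ?\<eta>) T"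
      using val_ty_subst[OF tm_coh.hyps(3) T] by (simp add: s)
    have w: "wrap (core_env \<Gamma> \<gamma>) (subst_ty \<Delta> \<delta> T) = wrap (core_env \<Delta> ?\<eta>) T"
      using wrap_ty_subst[OF tm_coh.hyps(3) T] by (simp add: s fun_eq_iff)
    show ?thesis
      unfolding v w interp_subst(2)[OF tm_coh.hyps(3) T]
      using tm_coh.IH(2) \<eta> by (simp add: interp_ok_ty_def coh_op_def s)
  qed
  then show ?case
    using tm_coh.IH unfolding interp_ok_ty_def interp_ok_tm_def by blast
qed auto

lemma coh_op_typed:
  assumes "contractible \<Delta>" "ty_ok \<Delta> T" "\<eta> \<in> cells_con \<Delta>"
  shows "coh_op \<Delta> T \<eta> \<in> Ob (cells_ty \<Delta> T \<eta>)"
proof -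
  have g: "interp_ok_con \<Delta>" "interp_ok_ty \<Delta> T" and s: "sound_con \<Delta>" "sound_ty \<Delta> T" "coherent \<Delta>"
    and wf: "wf_con \<Delta>" "scoped_ty (con_vars \<Delta>) T"
    using assms interpretation_ok(3) soundness(3,5) typed_scoped(3) by blast+
  have "has_type M (val_con \<Delta>) (coherence \<Delta> (ty_dim T) (open_ty \<Delta> T)) (open_ty \<Delta> T)"
    using coherent_coh[OF wf(2) s(2,3)] by blast
  from has_type_sub[OF core_is_subst[OF wf(1) s(1) g(1) assms(3)] this] show ?thesis
    unfolding open_sub[OF wf(2)] coh_op_def interp_ok_Ob[OF g(2) assms(3)] by blast
qed

lemma weak_groupoid: "weak_infinity_groupoid (type_globular M A) coh_op"
proof -
  have "partial_weak_groupoid n (type_globular M A) coh_op" for n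
    by (induction n) (auto simp: globular_type_globular coh_op_typed)
  then show ?thesis
    by (simp add: weak_infinity_groupoid_def)
qed

end

theorem propositionA4p8:
  fixes M :: "('T, 't) type_theory" and A :: 'T
  assumes "type_theory_with_identity_types M"
    and "is_type M [] A"
  shows "\<exists>c. weak_infinity_groupoid (type_globular M A) c"
proof -
  interpret closed_type M A
    using assms by (simp add: closed_type_def closed_type_axioms_def)
  show ?thesis
    using weak_groupoid by blast
qed

end
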